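(* Let $\Delta_*>0$ be fixed, and let $\tau$ be the associated separation constant. (Regimes 1 and 2.) There exists $\varepsilon_{\Delta_*}>0$ such that, for all $\Delta\ge\Delta_*$, all $(n,N_1)\in\mathbb{N}^2$ with $1\le n\le N_1$, and all $\varepsilon\in[0,\varepsilon_{\Delta_*}]$, the perturbed Prony polynomial $\bar q(z)$ corresponding to $\varepsilon$ has a root $\hat\phi_n^{Pr}$ satisfying $$|\phi_n-\hat\phi_n^{Pr}|\le\tau\phi_n.$$ (Regime 3.) Analogously, let $T>0$ be fixed and let $\Delta=T/N_1$. There exists $\varepsilon_T>0$ such that, for all $(n,N_1)\in\mathbb{N}^2$ with $1\le n\le N_1$ and all $\varepsilon\in[0,\varepsilon_T]$, the perturbed Prony polynomial $\bar q(z)$ corresponding to $\varepsilon$ has a root $\hat\phi_n^{Pr}$ satisfying $|\phi_n-\hat\phi_n^{Pr}|\le\tau\phi_n$.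
   Context: Let $\mathcal{A}$ be a fixed Sturm-Liouville operator $[\mathcal{A}h](x)=-(p(x)h'(x))'-q(x)h(x)$, $x\in(0,1)$, with domain $\{h\in \mathrm{H}^2(0,1): h(0)=h(1)=0\}$, where $p,q$ are smooth real functions on $[0,1]$ (restrictions of smooth functions defined on a neighborhood of $[0,1]$) and $\min_{[0,1]}p>0$. Let $\{\lambda_n\}_{n=1}^\infty$ be the monotonically increasing, unbounded real sequence of its simple eigenvalues. For $\Delta>0$ put $\phi_n:=e^{-\lambda_n\Delta}$. The separation constant $\tau\in(0,\frac12)$ is a constant depending only on $\Delta_*$ such that $|\phi_j-\phi_n|/\phi_n\ge2\tau$ for all $n\in\mathbb{N}$, $j\in\mathbb{N}\setminus\{n\}$ and $\Delta\ge\Delta_*$ (such a constant exists). The real amplitudes $y_1,\dots,y_{N_1+1}$ satisfy, with constants $\ell>1$ and $M_y>0$ not depending on $N_1,\Delta$: $\ell^{-1}\le|y_n|\le\ell$ for $1\le n\le N_1$ and $|y_{N_1+1}|/|y_k|\le M_y$ for $1\le k\le N_1$. Measurements with noise intensity $\varepsilon\ge0$: $\tilde m_k=\sum_{n=1}^{N_1}y_n\phi_n^k+\varepsilon y_{N_1+1}\phi_{N_1+1}^k$, $k=0,\dots,2N_1-1$. The perturbed Prony polynomial is $$\bar q(z)=\det\begin{bmatrix}1&z&\cdots&z^{N_1}\\ \tilde m_0&\tilde m_1&\cdots&\tilde m_{N_1}\\ \vdots&\vdots&&\vdots\\ \tilde m_{N_1-1}&\tilde m_{N_1}&\cdots&\tilde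 m_{2N_1-1}\end{bmatrix}.$$ Regime 1: $\Delta$ fixed, $N_1\to\infty$. Regime 2: $N_1$ large and fixed, $\Delta\to\infty$. Regime 3: $N_1\Delta=T$ fixed, $N_1\to\infty$. *)

theory Defs
  imports "HOL-Analysis.Analysis" "Jordan_Normal_Form.Determinant"
begin

definition smooth_near_unit :: "(real \<Rightarrow> real) \<Rightarrow> bool" where
  "smooth_near_unit f \<longleftrightarrow> (\<exists>F U. open U \<and> {0..1} \<subseteq> U \<and>
     (\<forall>k. ((deriv ^^ k) F) differentiable_on U) \<and> (\<forall>x\<in>{0..1}. F x = f x))"

abbreviation unit_measure :: "real measure" where
  "unit_measure \<equiv> lebesgue_on {0<..<1}"

definition L2_unit :: "(real \<Rightarrow> real) set" where
  "L2_unit = {f \<in> borel_measurable unit_measure. integrable unit_measure (\<lambda>x. (f x)\<^sup>2)}"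

text \<open>The test functions are those of class C1 with compact support in the open unit interval
  (as in Brezis's definition of the one-dimensional Sobolev spaces).\<close>

definition weak_deriv_of :: "(real \<Rightarrow> real) \<Rightarrow> (real \<Rightarrow> real) \<Rightarrow> bool" where
  "weak_deriv_of f g \<longleftrightarrow> (\<forall>\<psi> \<psi>'.
     (\<forall>x. (\<psi> has_real_derivative \<psi>' x) (at x)) \<and> continuous_on UNIV \<psi>' \<and>
     (\<exists>K. compact K \<and> K \<subseteq> {0<..<1} \<and> (\<forall>x. x \<notin> K \<longrightarrow> \<psi> x = 0)) \<longrightarrow>
     (LINT x|unit_measure. f x * \<psi>' x) = - (LINT x|unit_measure. g x * \<psi> x))"

definition H1_unit :: "(real \<Rightarrow> real) set" where
  "H1_unit = {f \<in> L2_unit. \<exists>g \<in> L2_unit. weak_deriv_of f g}"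

definition H2_unit :: "(real \<Rightarrow> real) set" where
  "H2_unit = {f \<in> L2_unit. \<exists>g \<in> H1_unit. weak_deriv_of f g}"

text \<open>Unique up to a null set, so every use below is insensitive to the choice.\<close>

definition weak_deriv :: "(real \<Rightarrow> real) \<Rightarrow> (real \<Rightarrow> real)" where
  "weak_deriv f = (SOME g. g \<in> L2_unit \<and> weak_deriv_of f g)"

text \<open>The boundary values of a Sobolev function are those of its continuous representative;
  the domain consists of these representatives.\<close>

definition SL_domain :: "(real \<Rightarrow> real) set" where
  "SL_domain = {h \<in> H2_unit. continuous_on {0..1} h \<and> h 0 = 0 \<and> h 1 = 0}"

definition SL_op :: "(real \<Rightarrow> real) \<Rightarrow> (real \<Rightarrow> real) \<Rightarrow> (real \<Rightarrow> real) \<Rightarrow> (real \<Rightarrow> real)" where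
  "SL_op p q h = (\<lambda>x. - weak_deriv (\<lambda>t. p t * weak_deriv h t) x - q x * h x)"

definition SL_eigenvalue :: "(real \<Rightarrow> real) \<Rightarrow> (real \<Rightarrow> real) \<Rightarrow> real \<Rightarrow> bool" where
  "SL_eigenvalue p q \<mu> \<longleftrightarrow> (\<exists>h \<in> SL_domain. \<not> (AE x in unit_measure. h x = 0) \<and>
     (AE x in unit_measure. SL_op p q h x = \<mu> * h x))"

text \<open>Sequences are indexed from 1; the value at 0 is never used.\<close>

definition SL_eigenvalue_seq :: "(real \<Rightarrow> real) \<Rightarrow> (real \<Rightarrow> real) \<Rightarrow> (nat \<Rightarrow> real) \<Rightarrow> bool" where
  "SL_eigenvalue_seq p q lam \<longleftrightarrow> strict_mono_on {1..} lam \<and>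
     lam ` {1..} = {\<mu>. SL_eigenvalue p q \<mu>} \<and> filterlim lam at_top sequentially"

definition node :: "(nat \<Rightarrow> real) \<Rightarrow> real \<Rightarrow> nat \<Rightarrow> real" where
  "node lam \<Delta> n = exp (- lam n * \<Delta>)"

definition separation_constant :: "(nat \<Rightarrow> real) \<Rightarrow> real \<Rightarrow> real \<Rightarrow> bool" where
  "separation_constant lam \<Delta>0 \<tau> \<longleftrightarrow> 0 < \<tau> \<and> \<tau> < 1/2 \<and>
     (\<forall>\<Delta>\<ge>\<Delta>0. \<forall>n\<ge>1. \<forall>j\<ge>1. j \<noteq> n \<longrightarrow>
        \<bar>node lam \<Delta> j - node lam \<Delta> n\<bar> / node lam \<Delta> n \<ge> 2 * \<tau>)"

definition admissible_amplitudes :: "real \<Rightarrow> real \<Rightarrow> nat \<Rightarrow> (nat \<Rightarrow> real) \<Rightarrow> bool" where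
  "admissible_amplitudes l M N y \<longleftrightarrow>
     (\<forall>n\<in>{1..N}. inverse l \<le> \<bar>y n\<bar> \<and> \<bar>y n\<bar> \<le> l) \<and>
     (\<forall>k\<in>{1..N}. \<bar>y (N + 1)\<bar> / \<bar>y k\<bar> \<le> M)"

definition noisy_moment ::
  "(nat \<Rightarrow> real) \<Rightarrow> real \<Rightarrow> nat \<Rightarrow> (nat \<Rightarrow> real) \<Rightarrow> real \<Rightarrow> nat \<Rightarrow> real" where
  "noisy_moment lam \<Delta> N y \<epsilon> k =
     (\<Sum>n=1..N. y n * node lam \<Delta> n ^ k) + \<epsilon> * y (N + 1) * node lam \<Delta> (N + 1) ^ k"

definition prony_poly ::
  "(nat \<Rightarrow> real) \<Rightarrow> real \<Rightarrow> nat \<Rightarrow> (nat \<Rightarrow> real) \<Rightarrow> real \<Rightarrow> complex poly" where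
  "prony_poly lam \<Delta> N y \<epsilon> = Determinant.det (Matrix.mat (N + 1) (N + 1)
     (\<lambda>(i, j). if i = 0 then monom 1 j
               else [: complex_of_real (noisy_moment lam \<Delta> N y \<epsilon> (i - 1 + j)) :]))"

end

theory Submission
  imports Defs "HOL-Complex_Analysis.Conformal_Mappings" "HOL-Real_Asymp.Real_Asymp"
begin

text \<open>Write \<open>\<phi>\<^sub>k\<close> for the nodes and \<open>L\<^sub>m\<close> for the Lagrange basis polynomials of \<open>\<phi>\<^sub>1, \<dots>, \<phi>\<^sub>N\<close>, and
put \<open>P(z) = \<Prod>(z - \<phi>\<^sub>k)\<close>, \<open>k \<le> N\<close>.  The noise is itself a node, \<open>\<phi>\<^sub>N\<^sub>+\<^sub>1\<close> with amplitude
\<open>\<epsilon> y\<^sub>N\<^sub>+\<^sub>1\<close>, so the perturbed data are the moments of a measure on \<open>N + 1\<close> points, and the Prony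
polynomial is, up to a factor, its orthogonal polynomial of degree \<open>N\<close>:
\<open>P(z) (1 + \<epsilon> \<Sum>\<^sub>m (y\<^sub>N\<^sub>+\<^sub>1 / y\<^sub>m) L\<^sub>m(\<phi>\<^sub>N\<^sub>+\<^sub>1)\<^sup>2 (z - \<phi>\<^sub>N\<^sub>+\<^sub>1) / (z - \<phi>\<^sub>m))\<close>.
If the sum stays bounded on a circle around \<open>\<phi>\<^sub>n\<close> of radius at most \<open>\<tau> \<phi>\<^sub>n\<close>, then for small \<open>\<epsilon>\<close>
the bracket is close to 1 there, and a root remains inside, as in Rouche's theorem
(\<open>prony_root_near_node\<close>).  Everything reduces to bounding the sum independently of \<open>N\<close>, \<open>n\<close>
and, in the first two regimes, of \<open>\<Delta>\<close>.

This rests on one fact about the spectrum: \<open>\<lambda>\<^sub>j - \<lambda>\<^sub>i \<ge> c (j\<^sup>2 - i\<^sup>2)\<close> for some \<open>c > 0\<close>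
(\<open>SL_eigenvalue_quadratic_gap\<close>).  For \<open>\<Delta> \<ge> \<Delta>\<^sub>*\<close> it makes the ratios \<open>\<phi>\<^sub>k / \<phi>\<^sub>m\<close> decay
geometrically, whence \<open>L\<^sub>m(\<phi>\<^sub>N\<^sub>+\<^sub>1)\<^sup>2\<close> is at most a constant times \<open>exp (- b (N - m))\<close>, which is
summable over \<open>m\<close>.  For \<open>\<Delta> = T / N\<close> the same happens for \<open>m \<ge> N / 2\<close>, since there the gaps of
\<open>\<lambda>\<^sub>k \<Delta>\<close> are bounded below.  The nodes with \<open>m < N / 2\<close> may be at relative distances of order \<open>1 / N\<close>
from each other, so the crowding can produce factors of order \<open>N\<^sup>N\<close>; but the product of the
\<open>\<phi>\<^sub>k / \<phi>\<^sub>m\<close>, \<open>k > m\<close>, contributes at most \<open>exp (- c T N\<^sup>2 / 24)\<close> to \<open>L\<^sub>m\<close>.  A linear gap would not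
bound the sum in this regime: for equally spaced \<open>\<lambda>\<^sub>k\<close> the value \<open>L\<^sub>N(\<phi>\<^sub>N\<^sub>+\<^sub>1)\<close> is of order \<open>N\<close>.

The gap follows from a comparison of eigenfunctions for nearby eigenvalues.  Eigenfunctions in the weak
sense are classical solutions by the lemma of du Bois-Reymond (\<open>SL_eigenvalue_classical\<close>).  For
\<open>\<mu> = \<omega>\<^sup>2\<close> an energy estimate whose constants do not depend on \<open>\<omega> \<ge> 1\<close> shows that normalised
eigenfunctions are bounded above, bounded below in mean square, and Lipschitz in \<open>\<omega>\<close>.  Two of them with
nearby frequencies would be nearly equal and so have a positive inner product, but they are
orthogonal.  Hence distinct frequencies keep a fixed distance (\<open>dirichlet_frequency_gap\<close>), and
squaring turns this into the quadratic gap.\<close>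

section \<open>Roots of the perturbed Prony polynomial\<close>

definition lagrange_basis :: "(nat \<Rightarrow> real) \<Rightarrow> nat \<Rightarrow> nat \<Rightarrow> real \<Rightarrow> real" where
  "lagrange_basis \<phi> N m x = (\<Prod>k\<in>{1..N}-{m}. (x - \<phi> k) / (\<phi> m - \<phi> k))"

lemma lagrange_basis_node:
  assumes "inj_on \<phi> {1..N}" "m \<in> {1..N}" "k \<in> {1..N}"
  shows "lagrange_basis \<phi> N m (\<phi> k) = (if k = m then 1 else 0)"
proof (cases "k = m")
  case True
  have "\<phi> m - \<phi> j \<noteq> 0" if "j \<in> {1..N}-{m}" for j
    using that assms inj_onD[OF assms(1), of m j] by auto
  then have "lagrange_basis \<phi> N m (\<phi> m) = 1"
    unfolding lagrange_basis_def by (intro prod.neutral ballI) simp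
  then show ?thesis using True by simp
next
  case False
  then have "lagrange_basis \<phi> N m (\<phi> k) = 0"
    unfolding lagrange_basis_def by (intro prod_zero bexI[of _ k]) (use assms in simp_all)
  then show ?thesis using False by simp
qed

text \<open>Both sides are polynomials in \<open>x\<close> of degree below \<open>N\<close> that agree at \<open>N\<close> points.
At \<open>x = \<phi>\<^sub>N\<^sub>+\<^sub>1\<close> this expresses the moments of the noise node through those of the true nodes.\<close>

lemma lagrange_basis_power_exact:
  assumes inj: "inj_on \<phi> {1..N}" and "i < N"
  shows "(\<Sum>m=1..N. lagrange_basis \<phi> N m x * \<phi> m ^ i) = x ^ i"
proof -
  define L where "L m = (\<Prod>k\<in>{1..N}-{m}. Polynomial.smult (1 / (\<phi> m - \<phi> k)) [:- \<phi> k, 1:])" for m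
  have L: "poly (L m) t = lagrange_basis \<phi> N m t" for m t
    unfolding L_def lagrange_basis_def poly_prod by (intro prod.cong) (auto simp: algebra_simps diff_divide_distrib)
  have degL: "degree (L m) \<le> N - 1" if "m \<in> {1..N}" for m
  proof -
    have "degree (L m) \<le> (\<Sum>k\<in>{1..N}-{m}. degree (Polynomial.smult (1 / (\<phi> m - \<phi> k)) [:- \<phi> k, 1:]))"
      unfolding L_def by (rule degree_prod_sum_le[unfolded o_def]) auto
    also have "\<dots> \<le> (\<Sum>k\<in>{1..N}-{m}. 1)" by (rule sum_mono) auto
    also have "\<dots> = N - 1" using that by simp
    finally show ?thesis .
  qed
  define D where "D = (\<Sum>m=1..N. Polynomial.smult (\<phi> m ^ i) (L m)) - monom 1 i"
  have Dt: "poly D t = (\<Sum>m=1..N. lagrange_basis \<phi> N m t * \<phi> m ^ i) - t ^ i" for t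
    unfolding D_def by (simp add: poly_sum L poly_monom mult.commute)
  have "D = 0"
  proof (rule ccontr)
    assume "D \<noteq> 0"
    have "degree D \<le> N - 1" unfolding D_def
      using degL \<open>i < N\<close>
      by (intro degree_diff_le degree_sum_le) (auto intro: order.trans[OF degree_smult_le] order.trans[OF degree_monom_le])
    moreover have "\<phi> ` {1..N} \<subseteq> {t. poly D t = 0}"
    proof safe
      fix k assume k: "k \<in> {1..N}"
      have "(\<Sum>m=1..N. lagrange_basis \<phi> N m (\<phi> k) * \<phi> m ^ i) = (\<Sum>m=1..N. if k = m then \<phi> m ^ i else 0)"
        by (rule sum.cong) (use lagrange_basis_node[OF inj _ k] in auto)
      then show "poly D (\<phi> k) = 0" unfolding Dt using k by simp
    qed
    then have "card (\<phi> ` {1..N}) \<le> card {t. poly D t = 0}"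
      using \<open>D \<noteq> 0\<close> by (intro card_mono poly_roots_finite)
    then have "N \<le> card {t. poly D t = 0}" using card_image[OF inj] by simp
    ultimately show False using card_poly_roots_bound[OF \<open>D \<noteq> 0\<close>] \<open>i < N\<close> by linarith
  qed
  then show ?thesis using Dt[of x] by simp
qed

text \<open>The coefficient vector of \<open>r\<close> lies in the kernel of the Prony matrix evaluated at \<open>z\<close>: the first row gives
\<open>r(z)\<close>, the others give the discrete orthogonality of \<open>r\<close> to \<open>1, \<dots>, t\<^sup>N\<^sup>-\<^sup>1\<close>.  This locates roots of
the determinant without expanding it.\<close>

lemma prony_poly_zero_of_orthogonal:
  fixes r :: "complex poly"
  assumes "degree r \<le> N" "r \<noteq> 0" "poly r z = 0"
    and orth: "\<And>i. i < N \<Longrightarrow> (\<Sum>n=1..N. of_real (y n * node lam \<Delta> n ^ i) * poly r (of_real (node lam \<Delta> n)))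
       + of_real (\<epsilon> * y (N + 1) * node lam \<Delta> (N + 1) ^ i) * poly r (of_real (node lam \<Delta> (N + 1))) = 0"
  shows "poly (prony_poly lam \<Delta> N y \<epsilon>) z = 0"
proof -
  define A where "A = Matrix.mat (N + 1) (N + 1)
     (\<lambda>(i, j). if i = 0 then z ^ j else of_real (noisy_moment lam \<Delta> N y \<epsilon> (i - 1 + j)) :: complex)"
  have A: "A \<in> carrier_mat (N+1) (N+1)" unfolding A_def by simp
  interpret ev: comm_ring_hom "\<lambda>p. poly p z"
    by unfold_locales auto
  have "poly (prony_poly lam \<Delta> N y \<epsilon>) z = Determinant.det A"
    unfolding prony_poly_def ev.hom_det[symmetric] A_def
    by (rule arg_cong[of _ _ Determinant.det], rule eq_matI) (auto simp: poly_monom)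
  moreover have "\<exists>v. v \<in> carrier_vec (N+1) \<and> v \<noteq> 0\<^sub>v (N+1) \<and> A *\<^sub>v v = 0\<^sub>v (N+1)"
  proof (intro exI conjI)
    define v where "v = Matrix.vec (N+1) (coeff r)"
    show "v \<in> carrier_vec (N+1)" unfolding v_def by simp
    show "v \<noteq> 0\<^sub>v (N+1)"
    proof
      assume "v = 0\<^sub>v (N+1)"
      then have "vec_index v (degree r) = 0" using assms(1) by simp
      then show False using assms(1,2) unfolding v_def by simp
    qed
    have ev: "poly r t = (\<Sum>j<N+1. coeff r j * t ^ j)" for t
      unfolding poly_altdef
      by (rule sum.mono_neutral_left) (use assms(1) in \<open>auto simp: coeff_eq_0\<close>)
    show "A *\<^sub>v v = 0\<^sub>v (N+1)"
    proof (rule eq_vecI)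
      fix i assume "i < dim_vec (0\<^sub>v (N+1) :: complex vec)"
      then have i: "i < N+1" by simp
      have Av: "vec_index (A *\<^sub>v v) i = (\<Sum>j<N+1. (if i = 0 then z ^ j else of_real (noisy_moment lam \<Delta> N y \<epsilon> (i - 1 + j))) * coeff r j)"
        using i unfolding A_def v_def by (simp add: scalar_prod_def atLeast0LessThan del: sum.lessThan_Suc)
      show "vec_index (A *\<^sub>v v) i = vec_index (0\<^sub>v (N+1)) i"
      proof (cases "i = 0")
        case True
        then show ?thesis using Av ev[of z] assms(3) by (simp add: mult.commute)
      next
        case False
        let ?x = "\<lambda>n. complex_of_real (node lam \<Delta> n)"
        have "vec_index (A *\<^sub>v v) i = (\<Sum>j<N+1. (\<Sum>n=1..N. of_real (y n) * ?x n ^ (i-1) * (coeff r j * ?x n ^ j))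
            + of_real (\<epsilon> * y (N+1)) * ?x (N+1) ^ (i-1) * (coeff r j * ?x (N+1) ^ j))"
          unfolding Av
        proof (intro sum.cong refl)
          fix j
          have "(\<Sum>n=1..N. of_real (y n) * ?x n ^ (i-1+j)) * coeff r j
              = (\<Sum>n=1..N. of_real (y n) * ?x n ^ (i-1) * (coeff r j * ?x n ^ j))"
            unfolding sum_distrib_right by (intro sum.cong refl) (simp add: power_add)
          then show "(if i = 0 then z ^ j else of_real (noisy_moment lam \<Delta> N y \<epsilon> (i - 1 + j))) * coeff r j
            = (\<Sum>n=1..N. of_real (y n) * ?x n ^ (i-1) * (coeff r j * ?x n ^ j))
            + of_real (\<epsilon> * y (N+1)) * ?x (N+1) ^ (i-1) * (coeff r j * ?x (N+1) ^ j)"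
            using False by (simp add: noisy_moment_def distrib_right power_add[symmetric])
        qed
        also have "\<dots> = (\<Sum>n=1..N. \<Sum>j<N+1. of_real (y n) * ?x n ^ (i-1) * (coeff r j * ?x n ^ j))
            + (\<Sum>j<N+1. of_real (\<epsilon> * y (N+1)) * ?x (N+1) ^ (i-1) * (coeff r j * ?x (N+1) ^ j))"
          unfolding sum.distrib by (subst sum.swap) simp
        also have "\<dots> = (\<Sum>n=1..N. of_real (y n) * ?x n ^ (i-1) * poly r (?x n))
            + of_real (\<epsilon> * y (N+1)) * ?x (N+1) ^ (i-1) * poly r (?x (N+1))"
          unfolding ev sum_distrib_left ..
        also have "\<dots> = 0" using orth[of "i-1"] i False by (simp add: mult.assoc)
        finally show ?thesis using i by simp
      qed
    qed (simp add: A_def)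
  qed
  ultimately show ?thesis using det_0_iff_vec_prod_zero[OF A] by simp
qed

text \<open>A form of Rouche's theorem that follows from the maximum modulus principle.  If \<open>r\<close> had no zero in the
disc, \<open>exp (- P / r)\<close> would be holomorphic there with value 1 at the centre, whereas on the circle
\<open>r / P\<close> stays close to 1, so that \<open>P / r\<close> has positive real part and the modulus is below 1.\<close>

lemma poly_zero_in_disc_of_near_poly:
  fixes P r :: "complex poly"
  assumes "\<rho> > 0" "poly P c = 0"
    and near: "\<And>z. cmod (z - c) = \<rho> \<Longrightarrow> poly P z \<noteq> 0 \<and> cmod (poly r z / poly P z - 1) \<le> 1/2"
  shows "\<exists>z. poly r z = 0 \<and> cmod (c - z) \<le> \<rho>"
proof (rule ccontr)
  assume "\<not> ?thesis"
  then have nz: "poly r z \<noteq> 0" if "z \<in> cball c \<rho>" for z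
    using that by (auto simp: dist_norm)
  define F where "F z = exp (- (poly P z / poly r z))" for z
  have hol: "F holomorphic_on (cball c \<rho>)"
    unfolding F_def by (intro holomorphic_intros nz)
  have "cmod (F c) \<le> exp (- (2/9))"
  proof (rule maximum_modulus_frontier[of F "cball c \<rho>"])
    show "F holomorphic_on interior (cball c \<rho>)"
      using hol by (rule holomorphic_on_subset) (simp add: ball_subset_cball)
    show "continuous_on (closure (cball c \<rho>)) F"
      using holomorphic_on_imp_continuous_on[OF hol] by simp
    fix z assume "z \<in> frontier (cball c \<rho>)"
    then have "cmod (z - c) = \<rho>"
      using \<open>\<rho> > 0\<close> by (simp add: dist_norm norm_minus_commute)
    note n = near[OF this]
    define w where "w = poly r z / poly P z"
    have w: "cmod (w - 1) \<le> 1/2" using n w_def by simp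
    have re: "Re w \<ge> 1/2" using w abs_Re_le_cmod[of "w - 1"] by simp
    have le: "cmod w \<le> 3/2" using w norm_triangle_ineq[of "w - 1" 1] by simp
    have pos: "cmod w > 0" using re by auto
    have "Re (1 / w) = Re w / (cmod w)\<^sup>2"
      by (simp add: Re_divide cmod_power2)
    also have "\<dots> \<ge> (1/2) / (3/2)\<^sup>2"
      using re le pos by (intro frac_le power_mono) auto
    finally have "Re (1 / w) \<ge> 2/9" by (simp add: power2_eq_square)
    moreover have "1 / w = poly P z / poly r z" unfolding w_def by simp
    ultimately show "cmod (F z) \<le> exp (- (2/9))"
      unfolding F_def norm_exp_eq_Re by simp
  qed (use \<open>\<rho> > 0\<close> in auto)
  moreover have "F c = 1" unfolding F_def using assms(2) by simp
  ultimately show False by simp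
qed

text \<open>The explicit orthogonal polynomial \<open>r\<close> for the \<open>N + 1\<close> point measure is a perturbation of the
polynomial \<open>P\<close> with the exact nodes as roots; the assumption \<open>small\<close> bounds \<open>r / P - 1\<close>.\<close>

lemma prony_root_near_node:
  fixes lam :: "nat \<Rightarrow> real" and y :: "nat \<Rightarrow> real" and \<Delta> :: real
  defines "\<phi> \<equiv> \<lambda>k. node lam \<Delta> k"
  assumes inj: "inj_on \<phi> {1..N+1}" and n: "n \<in> {1..N}" and y: "\<And>m. m \<in> {1..N} \<Longrightarrow> y m \<noteq> 0"
    and "\<epsilon> \<ge> 0" "\<rho> > 0"
    and avoid: "\<And>z m. cmod (z - of_real (\<phi> n)) = \<rho> \<Longrightarrow> m \<in> {1..N} \<Longrightarrow> z \<noteq> of_real (\<phi> m)"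
    and small: "\<And>z. cmod (z - of_real (\<phi> n)) = \<rho> \<Longrightarrow>
       (\<Sum>m=1..N. \<epsilon> * (\<bar>y (N+1)\<bar> / \<bar>y m\<bar>) * (lagrange_basis \<phi> N m (\<phi> (N+1)))\<^sup>2
          * (cmod (z - of_real (\<phi> (N+1))) / cmod (z - of_real (\<phi> m)))) \<le> 1/2"
  shows "\<exists>z. poly (prony_poly lam \<Delta> N y \<epsilon>) z = 0 \<and> cmod (of_real (\<phi> n) - z) \<le> \<rho>"
proof -
  define x where "x k = complex_of_real (\<phi> k)" for k
  define L where "L m = lagrange_basis \<phi> N m (\<phi> (N+1))" for m
  define a where "a m = \<epsilon> * (y (N+1) / y m) * (L m)\<^sup>2" for m
  define P where "P = (\<Prod>k\<in>{1..N}. [:- x k, 1:])"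
  define Q where "Q m = (\<Prod>k\<in>{1..N}-{m}. [:- x k, 1:])" for m
  \<comment> \<open>Heine's expansion of the Prony determinant over the N-element subsets of the nodes,
    divided by the coefficient that belongs to the set of exact nodes.\<close>
  define r where "r = P + (\<Sum>m=1..N. Polynomial.smult (of_real (a m)) ([:- x (N+1), 1:] * Q m))"
  have Pt: "poly P t = (\<Prod>k\<in>{1..N}. t - x k)" for t
    unfolding P_def poly_prod by (simp add: algebra_simps)
  have Qt: "poly (Q m) t = (\<Prod>k\<in>{1..N}-{m}. t - x k)" for m t
    unfolding Q_def poly_prod by (simp add: algebra_simps)
  have PQ: "poly P t = (t - x m) * poly (Q m) t" if "m \<in> {1..N}" for m t
    unfolding Pt Qt using that by (simp add: prod.remove)
  have rt: "poly r t = poly P t + (\<Sum>m=1..N. of_real (a m) * ((t - x (N+1)) * poly (Q m) t))" for t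
    unfolding r_def by (simp add: poly_sum algebra_simps)
  have injx: "x k \<noteq> x j" if "k \<in> {1..N+1}" "j \<in> {1..N+1}" "k \<noteq> j" for k j
    using that inj unfolding x_def inj_on_def by auto
  have PN: "poly P (x (N+1)) \<noteq> 0"
    unfolding Pt using injx by auto
  have rN: "poly r (x (N+1)) = poly P (x (N+1))" unfolding rt by simp
  have Qm: "poly (Q m) (x m) \<noteq> 0" if "m \<in> {1..N}" for m
    unfolding Qt using injx that by auto
  have Qk: "poly (Q m) (x k) = 0" if "k \<in> {1..N}" "k \<noteq> m" for m k
    unfolding Qt using that by auto
  have Lm: "of_real (L m) = poly (Q m) (x (N+1)) / poly (Q m) (x m)" for m
    unfolding L_def lagrange_basis_def Qt x_def by (simp add: prod_dividef)
  \<comment> \<open>Multiplied by the amplitude, the values of r at the nodes are those of the basis polynomials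
    at the noise node, up to a common factor.\<close>
  have rm: "of_real (y m) * poly r (x m) = - (of_real (\<epsilon> * y (N+1)) * of_real (L m) * poly P (x (N+1)))"
    if m: "m \<in> {1..N}" for m
  proof -
    have "poly r (x m) = (\<Sum>k=1..N. if k = m then of_real (a m) * ((x m - x (N+1)) * poly (Q m) (x m)) else 0)"
    proof -
      have "(\<Sum>k=1..N. of_real (a k) * ((x m - x (N+1)) * poly (Q k) (x m)))
        = (\<Sum>k=1..N. if k = m then of_real (a m) * ((x m - x (N+1)) * poly (Q m) (x m)) else 0)"
        using Qk[OF m] by (intro sum.cong refl) auto
      then show ?thesis unfolding rt using PQ[OF m, of "x m"] by simp
    qed
    also have "\<dots> = of_real (a m) * ((x m - x (N+1)) * poly (Q m) (x m))" using m by simp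
    finally have "of_real (y m) * poly r (x m) = of_real (\<epsilon> * y (N+1)) * of_real (L m) * (of_real (L m) * (x m - x (N+1)) * poly (Q m) (x m))"
      using y[OF m] unfolding a_def by (simp add: power2_eq_square)
    also have "of_real (L m) * (x m - x (N+1)) * poly (Q m) (x m) = - poly P (x (N+1))"
      unfolding Lm PQ[OF m, of "x (N+1)"] using Qm[OF m] by (simp add: field_simps)
    finally show ?thesis by simp
  qed
  have degP: "degree P = N"
    unfolding P_def by (subst degree_prod_eq_sum_degree) auto
  have "degree r \<le> N" unfolding r_def
  proof (intro degree_add_le degree_sum_le)
    fix m assume m: "m \<in> {1..N}"
    have "degree (Q m) = N - 1"
      unfolding Q_def using m by (subst degree_prod_eq_sum_degree) auto
    then have "degree ([:- x (N+1), 1:] * Q m) \<le> 1 + (N - 1)"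
      using degree_mult_le[of "[:- x (N+1), 1:]" "Q m"] by simp
    then show "degree (Polynomial.smult (of_real (a m)) ([:- x (N+1), 1:] * Q m)) \<le> N"
      using m degree_smult_le[of "of_real (a m)" "[:- x (N+1), 1:] * Q m"] by simp
  qed (use degP in auto)
  moreover have "r \<noteq> 0" using rN PN by auto
  moreover have "(\<Sum>k=1..N. of_real (y k * \<phi> k ^ i) * poly r (x k))
       + of_real (\<epsilon> * y (N + 1) * \<phi> (N + 1) ^ i) * poly r (x (N + 1)) = 0" if i: "i < N" for i
  proof -
    have "(\<Sum>k=1..N. of_real (y k * \<phi> k ^ i) * poly r (x k))
        = (\<Sum>k=1..N. - (of_real (\<epsilon> * y (N+1)) * poly P (x (N+1))) * of_real (L k * \<phi> k ^ i))"
    proof (rule sum.cong)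
      fix k assume "k \<in> {1..N}"
      have "of_real (y k * \<phi> k ^ i) * poly r (x k) = of_real (\<phi> k ^ i) * (of_real (y k) * poly r (x k))"
        by simp
      then show "of_real (y k * \<phi> k ^ i) * poly r (x k) = - (of_real (\<epsilon> * y (N+1)) * poly P (x (N+1))) * of_real (L k * \<phi> k ^ i)"
        unfolding rm[OF \<open>k \<in> {1..N}\<close>] by simp
    qed simp
    also have "\<dots> = - (of_real (\<epsilon> * y (N+1)) * poly P (x (N+1))) * of_real (\<Sum>k=1..N. L k * \<phi> k ^ i)"
      unfolding sum_distrib_left[symmetric] of_real_sum ..
    also have "(\<Sum>k=1..N. L k * \<phi> k ^ i) = \<phi> (N+1) ^ i"
      unfolding L_def using inj i by (intro lagrange_basis_power_exact) (auto intro: inj_on_subset)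
    finally show ?thesis unfolding rN by simp
  qed
  ultimately have root: "poly (prony_poly lam \<Delta> N y \<epsilon>) z = 0" if "poly r z = 0" for z
    using prony_poly_zero_of_orthogonal[of r N z y lam \<Delta> \<epsilon>] that unfolding \<phi>_def x_def by blast
  have "\<exists>z. poly r z = 0 \<and> cmod (x n - z) \<le> \<rho>"
  proof (rule poly_zero_in_disc_of_near_poly[OF \<open>\<rho> > 0\<close>, of P])
    show "poly P (x n) = 0" using PQ[OF n] by simp
    fix z assume z: "cmod (z - x n) = \<rho>"
    have av: "z - x m \<noteq> 0" if "m \<in> {1..N}" for m
      using avoid[of z m] z that unfolding x_def by auto
    then have nz: "poly P z \<noteq> 0" unfolding Pt by auto
    have "poly r z / poly P z - 1 = (\<Sum>m=1..N. of_real (a m) * ((z - x (N+1)) / (z - x m)))"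
    proof -
      have "poly r z / poly P z - 1 = (\<Sum>m=1..N. of_real (a m) * ((z - x (N+1)) * poly (Q m) z) / poly P z)"
        unfolding rt using nz by (simp add: add_divide_distrib sum_divide_distrib)
      also have "\<dots> = (\<Sum>m=1..N. of_real (a m) * ((z - x (N+1)) / (z - x m)))"
      proof (rule sum.cong)
        fix m assume m: "m \<in> {1..N}"
        show "of_real (a m) * ((z - x (N+1)) * poly (Q m) z) / poly P z = of_real (a m) * ((z - x (N+1)) / (z - x m))"
          using nz av[OF m] unfolding PQ[OF m, of z] by simp
      qed simp
      finally show ?thesis .
    qed
    also have "cmod \<dots> \<le> (\<Sum>m=1..N. cmod (of_real (a m) * ((z - x (N+1)) / (z - x m))))"
      by (rule norm_sum)
    also have "\<dots> = (\<Sum>m=1..N. \<epsilon> * (\<bar>y (N+1)\<bar> / \<bar>y m\<bar>) * (lagrange_basis \<phi> N m (\<phi> (N+1)))\<^sup>2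
          * (cmod (z - of_real (\<phi> (N+1))) / cmod (z - of_real (\<phi> m))))"
      using \<open>\<epsilon> \<ge> 0\<close> by (intro sum.cong) (auto simp: a_def L_def x_def norm_mult norm_divide abs_mult abs_divide norm_power)
    also have "\<dots> \<le> 1/2" using small z unfolding x_def by blast
    finally show "poly P z \<noteq> 0 \<and> cmod (poly r z / poly P z - 1) \<le> 1 / 2" using nz by blast
  qed
  then show ?thesis using root unfolding x_def by blast
qed

section \<open>Lagrange basis polynomials at exponential nodes\<close>

lemma exp_diff_factor:
  fixes s t :: real
  shows "exp (- s) - exp (- t) = exp (- s) * (1 - exp (- (t - s)))"
  by (simp add: algebra_simps flip: exp_add)

lemma sum_exp_le_geometric:
  fixes b :: real
  assumes "b > 0" and "finite A" and inj: "inj_on f A"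
  shows "(\<Sum>j\<in>A. exp (- (b * real (f j)))) \<le> 1 / (1 - exp (- b))"
proof -
  have e: "exp (- (b * real k)) = exp (- b) ^ k" for k
    by (simp add: exp_of_nat_mult[symmetric] mult.commute)
  have s: "summable (\<lambda>k. exp (- b) ^ k)" using assms by (intro summable_geometric) auto
  have "(\<Sum>j\<in>A. exp (- (b * real (f j)))) = (\<Sum>k\<in>f ` A. exp (- b) ^ k)"
    unfolding e by (simp add: sum.reindex[OF inj])
  also have "\<dots> \<le> (\<Sum>k. exp (- b) ^ k)"
    using assms by (intro sum_le_suminf s) auto
  also have "\<dots> = 1 / (1 - exp (- b))"
    using assms by (intro suminf_geometric) auto
  finally show ?thesis .
qed

text \<open>Majorises the partial products of \<open>\<Prod>\<^sub>j 1 / (1 - exp (- b j))\<close>.\<close>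

definition geometric_product_bound :: "real \<Rightarrow> real" where
  "geometric_product_bound b = exp (1 / (1 - exp (- b))\<^sup>2)"

text \<open>Each factor is \<open>1 + exp (- x) / (1 - exp (- x))\<close>, at most the exponential of a multiple
of a term of a geometric series.
Injectivity of \<open>f\<close> makes each term occur at most once.\<close>

lemma prod_one_minus_exp_bound:
  fixes b :: real and x :: "'a \<Rightarrow> real"
  assumes "b > 0" "finite A" "inj_on f A"
    and f: "\<And>j. j \<in> A \<Longrightarrow> 1 \<le> f j" and x: "\<And>j. j \<in> A \<Longrightarrow> b * real (f j) \<le> x j"
  shows "(\<Prod>j\<in>A. 1 / (1 - exp (- x j))) \<le> geometric_product_bound b"
proof -
  define d where "d = 1 - exp (- b)"
  have d: "d > 0" unfolding d_def using assms by simp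
  have xb: "b \<le> x j" if "j \<in> A" for j
  proof -
    have "b * 1 \<le> b * real (f j)" using f[OF that] \<open>b > 0\<close> by (intro mult_left_mono) auto
    then show ?thesis using x[OF that] by simp
  qed
  have "(\<Prod>j\<in>A. 1 / (1 - exp (- x j))) \<le> (\<Prod>j\<in>A. exp (exp (- (b * real (f j))) / d))"
  proof (rule prod_mono)
    fix j assume j: "j \<in> A"
    have e: "1 - exp (- x j) \<ge> d" unfolding d_def using xb[OF j] by simp
    have "1 / (1 - exp (- x j)) = 1 + exp (- x j) / (1 - exp (- x j))"
    proof -
      have "1 - exp (- x j) \<noteq> 0" using e d by linarith
      then show ?thesis by (simp add: divide_simps)
    qed
    also have "\<dots> \<le> 1 + exp (- (b * real (f j))) / d"
      using e d x[OF j] by (intro add_left_mono frac_le) auto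
    also have "\<dots> \<le> exp (exp (- (b * real (f j))) / d)" by (rule exp_ge_add_one_self)
    finally show "0 \<le> 1 / (1 - exp (- x j)) \<and> 1 / (1 - exp (- x j)) \<le> exp (exp (- (b * real (f j))) / d)"
      using xb[OF j] \<open>b > 0\<close> by simp
  qed
  also have "\<dots> = exp ((\<Sum>j\<in>A. exp (- (b * real (f j)))) / d)"
    using assms by (simp add: exp_sum sum_divide_distrib)
  also have "\<dots> \<le> exp ((1 / d) / d)"
  proof -
    have "(\<Sum>j\<in>A. exp (- (b * real (f j)))) \<le> 1 / d"
      using sum_exp_le_geometric[OF assms(1-3)] unfolding d_def .
    from divide_right_mono[OF this, of d] show ?thesis using d by (simp only: exp_le_cancel_iff)
  qed
  finally show ?thesis unfolding geometric_product_bound_def d_def by (simp add: power2_eq_square)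
qed

text \<open>The numerators \<open>\<bar>\<phi>\<^sub>N\<^sub>+\<^sub>1 - \<phi>\<^sub>k\<bar>\<close> are at most \<open>\<phi>\<^sub>k\<close>.  For \<open>k < m\<close> the denominator is comparable to \<open>\<phi>\<^sub>k\<close>;
for \<open>k > m\<close> it is comparable to the larger \<open>\<phi>\<^sub>m\<close>, and the quotient gains the factor \<open>\<phi>\<^sub>k / \<phi>\<^sub>m\<close>.\<close>

lemma abs_lagrange_basis_exp_le:
  fixes x :: "nat \<Rightarrow> real"
  defines "\<phi> \<equiv> \<lambda>k. exp (- x k)"
  assumes mono: "\<And>i j. 1 \<le> i \<Longrightarrow> i < j \<Longrightarrow> j \<le> N + 1 \<Longrightarrow> x i < x j" and m: "m \<in> {1..N}"
  shows "\<bar>lagrange_basis \<phi> N m (\<phi> (N+1))\<bar>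
    \<le> (\<Prod>k\<in>{1..N}-{m}. 1 / (1 - exp (- \<bar>x m - x k\<bar>))) * exp (- (\<Sum>k\<in>{m<..N}. x k - x m))"
proof -
  define g where "g k = 1 / (1 - exp (- \<bar>x m - x k\<bar>)) * (if m < k then exp (- (x k - x m)) else 1)" for k
  have "\<bar>lagrange_basis \<phi> N m (\<phi> (N+1))\<bar> = (\<Prod>k\<in>{1..N}-{m}. \<bar>(\<phi> (N+1) - \<phi> k) / (\<phi> m - \<phi> k)\<bar>)"
    unfolding lagrange_basis_def abs_prod ..
  also have "\<dots> \<le> (\<Prod>k\<in>{1..N}-{m}. g k)"
  proof (rule prod_mono)
    fix k assume k: "k \<in> {1..N}-{m}"
    have num: "0 < \<phi> k - \<phi> (N+1)" "\<phi> k - \<phi> (N+1) \<le> \<phi> k"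
      using mono[of k "N+1"] k unfolding \<phi>_def by auto
    show "0 \<le> \<bar>(\<phi> (N+1) - \<phi> k) / (\<phi> m - \<phi> k)\<bar> \<and> \<bar>(\<phi> (N+1) - \<phi> k) / (\<phi> m - \<phi> k)\<bar> \<le> g k"
    proof (cases "m < k")
      case True
      have lt: "x m < x k" using mono[of m k] True m k by auto
      then have den: "\<phi> m - \<phi> k = \<phi> m * (1 - exp (- (x k - x m)))" "1 - exp (- (x k - x m)) > 0"
        unfolding \<phi>_def by (auto simp: exp_diff_factor)
      have "\<bar>(\<phi> (N+1) - \<phi> k) / (\<phi> m - \<phi> k)\<bar> \<le> \<phi> k / (\<phi> m * (1 - exp (- (x k - x m))))"
        unfolding abs_divide den(1) using num den(2) \<phi>_def
        by (intro frac_le) (auto simp: abs_mult)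
      also have "\<dots> = g k"
      proof -
        have "\<phi> k = \<phi> m * exp (- (x k - x m))" unfolding \<phi>_def by (simp flip: exp_add)
        then show ?thesis unfolding g_def using True lt \<phi>_def by (simp add: abs_if)
      qed
      finally show ?thesis by simp
    next
      case False
      then have "k < m" using k by auto
      then have lt: "x k < x m" using mono[of k m] m k by auto
      then have den: "\<phi> k - \<phi> m = \<phi> k * (1 - exp (- (x m - x k)))" "1 - exp (- (x m - x k)) > 0"
        unfolding \<phi>_def by (auto simp: exp_diff_factor)
      have "\<bar>(\<phi> (N+1) - \<phi> k) / (\<phi> m - \<phi> k)\<bar> = \<bar>\<phi> k - \<phi> (N+1)\<bar> / \<bar>\<phi> k - \<phi> m\<bar>"
        unfolding abs_divide by (simp add: abs_minus_commute)
      also have "\<dots> \<le> \<phi> k / (\<phi> k * (1 - exp (- (x m - x k))))"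
        unfolding den(1) using num den(2) \<phi>_def
        by (intro frac_le) (auto simp: abs_mult)
      also have "\<dots> = g k"
        unfolding g_def using False lt \<phi>_def by (simp add: abs_if)
      finally show ?thesis by simp
    qed
  qed
  also have "\<dots> = (\<Prod>k\<in>{1..N}-{m}. 1 / (1 - exp (- \<bar>x m - x k\<bar>)))
      * (\<Prod>k\<in>{1..N}-{m}. if m < k then exp (- (x k - x m)) else 1)"
    unfolding g_def by (rule prod.distrib)
  also have "(\<Prod>k\<in>{1..N}-{m}. if m < k then exp (- (x k - x m)) else 1)
      = (\<Prod>k\<in>{m<..N}. exp (- (x k - x m)))"
    using m by (intro prod.mono_neutral_cong_right) auto
  also have "\<dots> = exp (- (\<Sum>k\<in>{m<..N}. x k - x m))"
    by (simp add: exp_sum[symmetric] sum_negf[symmetric])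
  finally show ?thesis .
qed

text \<open>With linearly separated exponents the product over \<open>k\<close> converges on each side of \<open>m\<close>, and the \<open>N - m\<close>
factors \<open>\<phi>\<^sub>k / \<phi>\<^sub>m\<close> leave exponential decay in \<open>N - m\<close>.\<close>

lemma lagrange_basis_separated:
  fixes x :: "nat \<Rightarrow> real"
  defines "\<phi> \<equiv> \<lambda>k. exp (- x k)"
  assumes mono: "\<And>i j. 1 \<le> i \<Longrightarrow> i < j \<Longrightarrow> j \<le> N + 1 \<Longrightarrow> x i < x j" and m: "m \<in> {1..N}"
    and "b > 0"
    and lo: "\<And>k. 1 \<le> k \<Longrightarrow> k < m \<Longrightarrow> b * real (m - k) \<le> x m - x k"
    and hi: "\<And>k. m < k \<Longrightarrow> k \<le> N \<Longrightarrow> b * real (k - m) \<le> x k - x m"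
  shows "(lagrange_basis \<phi> N m (\<phi> (N+1)))\<^sup>2 \<le> geometric_product_bound b ^ 4 * exp (- (b * real (N - m)))"
proof -
  define G where "G = geometric_product_bound b"
  have G: "G > 0" unfolding G_def geometric_product_bound_def by simp
  define p where "p k = 1 / (1 - exp (- \<bar>x m - x k\<bar>))" for k
  have p: "p k \<ge> 0" for k unfolding p_def by simp
  have "prod p {1..<m} \<le> G" unfolding p_def G_def
    by (rule prod_one_minus_exp_bound[OF \<open>b > 0\<close>, of _ "\<lambda>k. m - k"])
       (auto simp: inj_on_def simp del: of_nat_diff intro!: order.trans[OF lo])
  moreover have "prod p {m<..N} \<le> G" unfolding p_def G_def
    by (rule prod_one_minus_exp_bound[OF \<open>b > 0\<close>, of _ "\<lambda>k. k - m"])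
       (auto simp: inj_on_def simp del: of_nat_diff intro!: order.trans[OF hi])
  moreover have "{1..N} - {m} = {1..<m} \<union> {m<..N}" using m by auto
  then have "prod p ({1..N} - {m}) = prod p {1..<m} * prod p {m<..N}"
    using prod.union_disjoint[of "{1..<m}" "{m<..N}" p] by fastforce
  ultimately have P: "prod p ({1..N} - {m}) \<le> G * G"
    using G p by (auto intro!: mult_mono prod_nonneg)
  have S: "(\<Sum>k\<in>{m<..N}. x k - x m) \<ge> b * real (N - m)"
  proof -
    have "(\<Sum>k\<in>{m<..N}. b) \<le> (\<Sum>k\<in>{m<..N}. x k - x m)"
    proof (rule sum_mono)
      fix k assume k: "k \<in> {m<..N}"
      have "b * 1 \<le> b * real (k - m)" using k \<open>b > 0\<close> by (intro mult_left_mono) auto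
      also have "\<dots> \<le> x k - x m" using k by (intro hi) auto
      finally show "b \<le> x k - x m" by simp
    qed
    then show ?thesis by (simp add: mult.commute)
  qed
  have "\<bar>lagrange_basis \<phi> N m (\<phi> (N+1))\<bar> \<le> prod p ({1..N} - {m}) * exp (- (\<Sum>k\<in>{m<..N}. x k - x m))"
    using abs_lagrange_basis_exp_le[of N x m] mono m unfolding \<phi>_def p_def by blast
  also have "\<dots> \<le> (G * G) * exp (- (b * real (N - m)))"
    using P S G p by (intro mult_mono) (auto intro: prod_nonneg)
  finally have "\<bar>lagrange_basis \<phi> N m (\<phi> (N+1))\<bar>\<^sup>2 \<le> ((G * G) * exp (- (b * real (N - m))))\<^sup>2"
    by (intro power_mono) auto
  then have "(lagrange_basis \<phi> N m (\<phi> (N+1)))\<^sup>2 \<le> G ^ 4 * (exp (- (b * real (N - m))) * exp (- (b * real (N - m))))"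
    by (simp add: power2_eq_square power4_eq_xxxx mult_ac)
  also have "\<dots> \<le> G ^ 4 * (exp (- (b * real (N - m))) * 1)"
    using G \<open>b > 0\<close> by (intro mult_left_mono) auto
  finally show ?thesis unfolding G_def by simp
qed

lemma sum_lagrange_basis_separated_le:
  assumes "b > 0"
  shows "(\<Sum>m\<in>{1..N}. geometric_product_bound b ^ 4 * exp (- (b * real (N - m)))) \<le> geometric_product_bound b ^ 4 / (1 - exp (- b))"
proof -
  have "(\<Sum>m\<in>{1..N}. exp (- (b * real (N - m)))) \<le> 1 / (1 - exp (- b))"
    by (rule sum_exp_le_geometric[OF assms]) (auto simp: inj_on_def)
  from mult_left_mono[OF this, of "geometric_product_bound b ^ 4"] show ?thesis
    by (simp add: sum_distrib_left)
qed

lemma sum_square_differences_ge: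
  assumes "2 * m < N"
  shows "real N ^ 3 / 24 \<le> (\<Sum>k\<in>{m<..N}. (real k)\<^sup>2 - (real m)\<^sup>2)"
proof -
  have cube: "real n ^ 3 / 3 \<le> (\<Sum>i=1..n. (real i)\<^sup>2)" for n
    by (induction n) (auto simp: power2_eq_square power3_eq_cube algebra_simps)
  have "(real N / 2) ^ 3 \<le> real (N - m) ^ 3"
    using assms by (intro power_mono) auto
  then have "real N ^ 3 / 24 \<le> real (N - m) ^ 3 / 3" by (simp add: power_divide)
  also have "\<dots> \<le> (\<Sum>i=1..N-m. (real i)\<^sup>2)" by (rule cube)
  also have "\<dots> = (\<Sum>k\<in>{m<..N}. (real (k - m))\<^sup>2)"
    by (rule sum.reindex_bij_witness[of _ "\<lambda>k. k - m" "\<lambda>i. i + m"]) auto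
  also have "\<dots> \<le> (\<Sum>k\<in>{m<..N}. (real k)\<^sup>2 - (real m)\<^sup>2)"
    by (rule sum_mono) (auto simp: power2_eq_square algebra_simps intro!: mult_right_mono)
  finally show ?thesis .
qed

text \<open>The exponents may be as close as \<open>\<beta> / N\<close> here, so each of the \<open>N\<close> factors can be as large as
\<open>1 + N / \<beta>\<close>.  The gain from the \<open>\<phi>\<^sub>k / \<phi>\<^sub>m\<close> with \<open>k > m\<close> is the exponential of \<open>- \<beta> / N\<close> times a sum
of order \<open>N\<^sup>3\<close>.\<close>

lemma lagrange_basis_crowded:
  fixes x :: "nat \<Rightarrow> real"
  defines "\<phi> \<equiv> \<lambda>k. exp (- x k)"
  assumes m: "m \<in> {1..N}" and "\<beta> > 0" and "2 * m < N"
    and gap: "\<And>i j. 1 \<le> i \<Longrightarrow> i < j \<Longrightarrow> j \<le> N + 1 \<Longrightarrow> \<beta> / real N * ((real j)\<^sup>2 - (real i)\<^sup>2) \<le> x j - x i"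
  shows "(lagrange_basis \<phi> N m (\<phi> (N+1)))\<^sup>2 \<le> (1 + real N / \<beta>) ^ (2 * N) * exp (- (\<beta> * (real N)\<^sup>2 / 12))"
proof -
  have N: "real N > 0" using m by auto
  have sq: "1 \<le> (real j)\<^sup>2 - (real i)\<^sup>2" if "i < j" for i j :: nat
  proof -
    have "1 * 1 \<le> (real j - real i) * (real j + real i)" using that by (intro mult_mono) auto
    then show ?thesis by (simp add: power2_eq_square algebra_simps)
  qed
  have gap1: "\<beta> / real N \<le> x j - x i" if "1 \<le> i" "i < j" "j \<le> N + 1" for i j
  proof -
    have "\<beta> / real N * 1 \<le> \<beta> / real N * ((real j)\<^sup>2 - (real i)\<^sup>2)"
      using N \<open>\<beta> > 0\<close> sq[OF that(2)] by (intro mult_left_mono) auto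
    then show ?thesis using gap[OF that] by simp
  qed
  have mono: "x i < x j" if "1 \<le> i" "i < j" "j \<le> N + 1" for i j
  proof -
    have "0 < \<beta> / real N" using N \<open>\<beta> > 0\<close> by simp
    then show ?thesis using gap1[OF that] by linarith
  qed
  define p where "p k = 1 / (1 - exp (- \<bar>x m - x k\<bar>))" for k
  have p: "p k \<ge> 0" for k unfolding p_def by simp
  have "prod p ({1..N} - {m}) \<le> (\<Prod>k\<in>{1..N} - {m}. 1 + real N / \<beta>)"
  proof (rule prod_mono)
    fix k assume k: "k \<in> {1..N} - {m}"
    define t where "t = \<bar>x m - x k\<bar>"
    have "k < m \<or> m < k" using k by auto
    then have t: "\<beta> / real N \<le> t" unfolding t_def using gap1[of k m] gap1[of m k] k m by auto
    then have t0: "t > 0" using N \<open>\<beta> > 0\<close> by (meson divide_pos_pos less_le_trans)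
    have "exp (- t) * (1 + t) \<le> exp (- t) * exp t" by (intro mult_left_mono exp_ge_add_one_self) auto
    then have "exp (- t) * (1 + t) \<le> 1" by (simp flip: exp_add)
    then have "1 / (1 - exp (- t)) \<le> 1 + 1 / t"
      using t0 by (simp add: field_simps)
    also have "1 / t \<le> real N / \<beta>"
      using t t0 N \<open>\<beta> > 0\<close> by (simp add: field_simps)
    finally show "0 \<le> p k \<and> p k \<le> 1 + real N / \<beta>" using p unfolding p_def t_def by auto
  qed
  also have "\<dots> \<le> (1 + real N / \<beta>) ^ N"
    using m \<open>\<beta> > 0\<close> by (simp add: power_increasing)
  finally have P: "prod p ({1..N} - {m}) \<le> (1 + real N / \<beta>) ^ N" .
  have S: "\<beta> * (real N)\<^sup>2 / 24 \<le> (\<Sum>k\<in>{m<..N}. x k - x m)"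
  proof -
    have "\<beta> * (real N)\<^sup>2 / 24 = \<beta> / real N * (real N ^ 3 / 24)"
      using N by (simp add: power2_eq_square power3_eq_cube)
    also have "\<dots> \<le> \<beta> / real N * (\<Sum>k\<in>{m<..N}. (real k)\<^sup>2 - (real m)\<^sup>2)"
      using N \<open>\<beta> > 0\<close> by (intro mult_left_mono sum_square_differences_ge assms) auto
    also have "\<dots> \<le> (\<Sum>k\<in>{m<..N}. x k - x m)"
      unfolding sum_distrib_left using m by (intro sum_mono gap) auto
    finally show ?thesis .
  qed
  have "\<bar>lagrange_basis \<phi> N m (\<phi> (N+1))\<bar> \<le> prod p ({1..N} - {m}) * exp (- (\<Sum>k\<in>{m<..N}. x k - x m))"
    using abs_lagrange_basis_exp_le[of N x m] mono m unfolding \<phi>_def p_def by blast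
  also have "\<dots> \<le> (1 + real N / \<beta>) ^ N * exp (- (\<beta> * (real N)\<^sup>2 / 24))"
    using P S p \<open>\<beta> > 0\<close> by (intro mult_mono) (auto intro: prod_nonneg)
  finally have "\<bar>lagrange_basis \<phi> N m (\<phi> (N+1))\<bar>\<^sup>2 \<le> ((1 + real N / \<beta>) ^ N * exp (- (\<beta> * (real N)\<^sup>2 / 24)))\<^sup>2"
    by (intro power_mono) auto
  also have "\<dots> = (1 + real N / \<beta>) ^ (2 * N) * exp (- (\<beta> * (real N)\<^sup>2 / 12))"
  proof -
    have "(exp (- (\<beta> * (real N)\<^sup>2 / 24)))\<^sup>2 = exp (- (\<beta> * (real N)\<^sup>2 / 12))"
      by (simp add: power2_eq_square[of "exp _"] flip: exp_add)
    then show ?thesis by (simp add: power_mult_distrib flip: power_mult) (simp add: mult.commute)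
  qed
  finally show ?thesis by simp
qed

text \<open>The logarithm of the growing factors is of order \<open>N log N\<close> only.\<close>

lemma crowded_bound_bounded:
  assumes "\<beta> > 0"
  shows "\<exists>K. \<forall>N. (real N)\<^sup>2 * ((1 + real N / \<beta>) ^ (2 * N) * exp (- (\<beta> * (real N)\<^sup>2 / 12))) \<le> K"
proof -
  have eq: "(1 + real N / \<beta>) ^ (2 * N) = exp (2 * real N * ln (1 + real N / \<beta>))" for N
  proof -
    have "0 < 1 + real N / \<beta>" using assms by (simp add: add_pos_nonneg)
    then show ?thesis using exp_of_nat_mult[of "2 * N" "ln (1 + real N / \<beta>)"] by simp
  qed
  have "(\<lambda>N::nat. (real N)\<^sup>2 * (exp (2 * real N * ln (1 + real N / \<beta>)) * exp (- (\<beta> * (real N)\<^sup>2 / 12)))) \<longlonglongrightarrow> 0"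
    using assms by real_asymp
  then have "Bseq (\<lambda>N::nat. (real N)\<^sup>2 * ((1 + real N / \<beta>) ^ (2 * N) * exp (- (\<beta> * (real N)\<^sup>2 / 12))))"
    unfolding eq by (intro convergent_imp_Bseq convergentI)
  then show ?thesis unfolding Bseq_def by (metis abs_le_D1 real_norm_def)
qed

text \<open>Pigeonhole: of \<open>N + 1\<close> candidates at mutual distance at least \<open>2 h\<close>, each point of \<open>S\<close> comes closer than
\<open>h\<close> to at most one.\<close>

lemma exists_point_away_from_finite_set:
  fixes a b :: real
  assumes "a < b" "finite S" "card S \<le> N"
  shows "\<exists>r. a \<le> r \<and> r \<le> b \<and> (\<forall>s\<in>S. (b - a) / (2 * (real N + 1)) \<le> \<bar>r - s\<bar>)"
proof (rule ccontr)
  assume no: "\<not> ?thesis"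
  define h where "h = (b - a) / (2 * (real N + 1))"
  have h: "h > 0" unfolding h_def using assms by simp
  have hb: "2 * (real N + 1) * h = b - a" unfolding h_def by (simp add: field_simps)
  define r where "r i = a + (2 * real i + 1) * h" for i :: nat
  have "\<exists>s\<in>S. \<bar>r i - s\<bar> < h" if "i \<le> N" for i
  proof -
    have "(2 * real i + 1) * h \<le> (2 * (real N + 1)) * h" using that h by (intro mult_right_mono) auto
    then have "a \<le> r i" "r i \<le> b" unfolding r_def hb using h by auto
    then show ?thesis using no unfolding h_def[symmetric] by (meson not_le)
  qed
  then obtain f where f: "\<And>i. i \<le> N \<Longrightarrow> f i \<in> S \<and> \<bar>r i - f i\<bar> < h" by metis
  have "inj_on f {..N}"
  proof (rule inj_onI, rule ccontr)
    fix i j assume ij: "i \<in> {..N}" "j \<in> {..N}" "f i = f j" "i \<noteq> j"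
    then have "\<bar>r i - r j\<bar> < 2 * h" using f[of i] f[of j] by auto
    moreover have "r i - r j = 2 * h * (real i - real j)" unfolding r_def by (simp add: algebra_simps)
    moreover have "\<bar>real i - real j\<bar> \<ge> 1" using ij(4) by (cases "i < j") auto
    then have "2 * h * 1 \<le> 2 * h * \<bar>real i - real j\<bar>" using h by (intro mult_left_mono) auto
    ultimately show False using h by (simp add: abs_mult)
  qed
  then have "card {..N} \<le> card S" using f assms(2) by (intro card_inj_on_le[of f]) auto
  then show False using assms(3) by simp
qed

section \<open>Roots near the nodes when eigenvalue gaps grow quadratically\<close>

text \<open>Splits the smallness condition into a bound \<open>R m\<close> on the geometry of the circle and a bound
\<open>C\<close> on the weighted sum of squared basis polynomials; the admissible noise depends on \<open>M\<close> and \<open>C\<close> alone.\<close>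

lemma prony_root_of_noise_bound:
  fixes lam :: "nat \<Rightarrow> real" and y :: "nat \<Rightarrow> real" and \<Delta> :: real
  defines "\<phi> \<equiv> \<lambda>k. node lam \<Delta> k"
  assumes inj: "inj_on \<phi> {1..N+1}" and n: "n \<in> {1..N}"
    and adm: "admissible_amplitudes l M N y" and "l > 1" "M > 0" "C > 0"
    and \<epsilon>: "\<epsilon> \<in> {0..1 / (2 * M * C)}" and "\<rho> > 0"
    and circle: "\<And>z m. cmod (z - of_real (\<phi> n)) = \<rho> \<Longrightarrow> m \<in> {1..N} \<Longrightarrow>
        z \<noteq> of_real (\<phi> m) \<and> cmod (z - of_real (\<phi> (N+1))) / cmod (z - of_real (\<phi> m)) \<le> R m"
    and sum: "(\<Sum>m=1..N. (lagrange_basis \<phi> N m (\<phi> (N+1)))\<^sup>2 * R m) \<le> C"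
  shows "\<exists>z. poly (prony_poly lam \<Delta> N y \<epsilon>) z = 0 \<and> cmod (of_real (\<phi> n) - z) \<le> \<rho>"
  unfolding \<phi>_def
proof (rule prony_root_near_node)
  show "y m \<noteq> 0" if "m \<in> {1..N}" for m
  proof -
    have "0 < inverse l" using \<open>l > 1\<close> by simp
    also have "\<dots> \<le> \<bar>y m\<bar>" using adm that unfolding admissible_amplitudes_def by blast
    finally show ?thesis by simp
  qed
  fix z assume "cmod (z - complex_of_real (node lam \<Delta> n)) = \<rho>"
  then have c: "z \<noteq> of_real (\<phi> m) \<and> cmod (z - of_real (\<phi> (N+1))) / cmod (z - of_real (\<phi> m)) \<le> R m"
    if "m \<in> {1..N}" for m
    using circle that unfolding \<phi>_def by blast
  show "z \<noteq> complex_of_real (node lam \<Delta> m)" if "m \<in> {1..N}" for m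
    using c[OF that] unfolding \<phi>_def by blast
  have "(\<Sum>m=1..N. \<epsilon> * (\<bar>y (N+1)\<bar> / \<bar>y m\<bar>) * (lagrange_basis \<phi> N m (\<phi> (N+1)))\<^sup>2
          * (cmod (z - of_real (\<phi> (N+1))) / cmod (z - of_real (\<phi> m))))
       \<le> (\<Sum>m=1..N. (\<epsilon> * M) * ((lagrange_basis \<phi> N m (\<phi> (N+1)))\<^sup>2 * R m))"
  proof (rule sum_mono)
    fix m assume m: "m \<in> {1..N}"
    have "\<bar>y (N+1)\<bar> / \<bar>y m\<bar> \<le> M" using adm m unfolding admissible_amplitudes_def by blast
    then have "\<epsilon> * (\<bar>y (N+1)\<bar> / \<bar>y m\<bar>) * (lagrange_basis \<phi> N m (\<phi> (N+1)))\<^sup>2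
          * (cmod (z - of_real (\<phi> (N+1))) / cmod (z - of_real (\<phi> m)))
       \<le> \<epsilon> * M * (lagrange_basis \<phi> N m (\<phi> (N+1)))\<^sup>2 * R m"
      using \<epsilon> c[OF m] \<open>M > 0\<close> by (intro mult_mono mult_nonneg_nonneg) auto
    then show "\<epsilon> * (\<bar>y (N+1)\<bar> / \<bar>y m\<bar>) * (lagrange_basis \<phi> N m (\<phi> (N+1)))\<^sup>2
          * (cmod (z - of_real (\<phi> (N+1))) / cmod (z - of_real (\<phi> m)))
       \<le> (\<epsilon> * M) * ((lagrange_basis \<phi> N m (\<phi> (N+1)))\<^sup>2 * R m)" by (simp only: mult.assoc)
  qed
  also have "\<dots> = (\<epsilon> * M) * (\<Sum>m=1..N. (lagrange_basis \<phi> N m (\<phi> (N+1)))\<^sup>2 * R m)"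
    by (rule sum_distrib_left[symmetric])
  also have "\<dots> \<le> (1 / (2 * M * C) * M) * C"
    using \<epsilon> sum \<open>M > 0\<close> \<open>C > 0\<close>
    by (meson atLeastAtMost_iff less_imp_le mult_left_mono mult_mono mult_nonneg_nonneg mult_right_mono order.trans)
  also have "\<dots> = 1 / 2" using \<open>M > 0\<close> \<open>C > 0\<close> by simp
  finally show "(\<Sum>m=1..N. \<epsilon> * (\<bar>y (N+1)\<bar> / \<bar>y m\<bar>) * (lagrange_basis (\<lambda>k. node lam \<Delta> k) N m (node lam \<Delta> (N+1)))\<^sup>2
          * (cmod (z - of_real (node lam \<Delta> (N+1))) / cmod (z - of_real (node lam \<Delta> m)))) \<le> 1/2"
    unfolding \<phi>_def .
qed (use assms in auto)

lemma node_strictly_decreasing: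
  assumes "\<And>i j. 1 \<le> i \<Longrightarrow> i < j \<Longrightarrow> lam i < lam j" and "\<Delta> > 0"
  shows "inj_on (\<lambda>k. node lam \<Delta> k) {1..}" 
    and "1 \<le> i \<Longrightarrow> i < j \<Longrightarrow> node lam \<Delta> j < node lam \<Delta> i"
    and "node lam \<Delta> j > 0"
proof -
  show *: "node lam \<Delta> j < node lam \<Delta> i" if "1 \<le> i" "i < j" for i j
    using assms(1)[OF that] \<open>\<Delta> > 0\<close> unfolding node_def by simp
  show "inj_on (\<lambda>k. node lam \<Delta> k) {1..}"
    by (rule linorder_inj_onI) (use * in force)+
  show "node lam \<Delta> j > 0" unfolding node_def by simp
qed

lemma quadratic_gap_linear:
  fixes i j :: nat
  assumes "c > 0" "1 \<le> i" "i < j"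
  shows "c * real (j - i) \<le> c * ((real j)\<^sup>2 - (real i)\<^sup>2)"
proof -
  have "real (j - i) * 1 \<le> (real j - real i) * (real j + real i)"
    using assms by (intro mult_mono) auto
  then show ?thesis using assms by (intro mult_left_mono) (auto simp: power2_eq_square algebra_simps)
qed

text \<open>The circle of radius \<open>\<tau> \<phi>\<^sub>n\<close> keeps the distance \<open>\<tau> \<phi>\<^sub>n\<close> from every node by the choice of \<open>\<tau>\<close>, so
all quotients \<open>\<bar>z - \<phi>\<^sub>N\<^sub>+\<^sub>1\<bar> / \<bar>z - \<phi>\<^sub>m\<bar>\<close> are at most \<open>2 / \<tau>\<close>.  As \<open>\<Delta> \<ge> \<Delta>0\<close>, the exponents
\<open>\<lambda>\<^sub>k \<Delta>\<close> are separated at least as well as \<open>\<lambda>\<^sub>k \<Delta>0\<close>, which gives a bound uniform in \<open>\<Delta>\<close>.\<close>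

theorem prony_root_separated_nodes:
  fixes lam :: "nat \<Rightarrow> real"
  assumes gap: "\<And>i j. 1 \<le> i \<Longrightarrow> i < j \<Longrightarrow> c * ((real j)\<^sup>2 - (real i)\<^sup>2) \<le> lam j - lam i"
    and "c > 0" "\<Delta>0 > 0" "l > 1" "M > 0" and sep: "separation_constant lam \<Delta>0 \<tau>"
  shows "\<exists>\<epsilon>0>0. \<forall>\<Delta>\<ge>\<Delta>0. \<forall>N n. 1 \<le> n \<and> n \<le> N \<longrightarrow>
            (\<forall>y. admissible_amplitudes l M N y \<longrightarrow> (\<forall>\<epsilon>\<in>{0..\<epsilon>0}.
               \<exists>z. poly (prony_poly lam \<Delta> N y \<epsilon>) z = 0 \<and>
                   cmod (complex_of_real (node lam \<Delta> n) - z) \<le> \<tau> * node lam \<Delta> n))"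
proof -
  define b where "b = c * \<Delta>0"
  have b: "b > 0" unfolding b_def using assms by simp
  have \<tau>: "0 < \<tau>" "\<tau> < 1/2" using sep unfolding separation_constant_def by auto
  have linear: "c * real (j - i) \<le> lam j - lam i" if "1 \<le> i" "i < j" for i j
    using quadratic_gap_linear[OF \<open>c > 0\<close> that] gap[OF that] by linarith
  have mono: "lam i < lam j" if "1 \<le> i" "i < j" for i j
  proof -
    have "0 < c * real (j - i)" using that \<open>c > 0\<close> by simp
    then show ?thesis using linear[OF that] by linarith
  qed
  define C where "C = geometric_product_bound b ^ 4 / (1 - exp (- b)) * (2 / \<tau>)"
  have C: "C > 0" unfolding C_def geometric_product_bound_def using b \<tau> by simp
  have "\<exists>z. poly (prony_poly lam \<Delta> N y \<epsilon>) z = 0 \<and>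
                   cmod (complex_of_real (node lam \<Delta> n) - z) \<le> \<tau> * node lam \<Delta> n"
    if \<Delta>: "\<Delta> \<ge> \<Delta>0" and n: "1 \<le> n" "n \<le> N" and adm: "admissible_amplitudes l M N y"
      and \<epsilon>: "\<epsilon> \<in> {0..1 / (2 * M * C)}" for \<Delta> N n y \<epsilon>
  proof -
    have "\<Delta> > 0" using \<Delta> \<open>\<Delta>0 > 0\<close> by linarith
    note nd = node_strictly_decreasing[of lam \<Delta>, OF mono \<open>\<Delta> > 0\<close>]
    define \<phi> where "\<phi> k = node lam \<Delta> k" for k
    have \<phi>x: "\<phi> = (\<lambda>k. exp (- (lam k * \<Delta>)))" unfolding \<phi>_def node_def by simp
    have xgap: "b * real (j - i) \<le> lam j * \<Delta> - lam i * \<Delta>" if "1 \<le> i" "i < j" for i j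
    proof -
      have "b * real (j - i) = (c * real (j - i)) * \<Delta>0" unfolding b_def by simp
      also have "\<dots> \<le> (lam j - lam i) * \<Delta>"
        using linear[OF that] mono[OF that] \<Delta> \<open>\<Delta>0 > 0\<close> by (intro mult_mono) auto
      finally show ?thesis by (simp add: algebra_simps)
    qed
    have L: "(lagrange_basis \<phi> N m (\<phi> (N+1)))\<^sup>2 \<le> geometric_product_bound b ^ 4 * exp (- (b * real (N - m)))" if "m \<in> {1..N}" for m
      unfolding \<phi>x
      by (rule lagrange_basis_separated) (use that b xgap mono \<open>\<Delta> > 0\<close> in auto)
    have "\<exists>z. poly (prony_poly lam \<Delta> N y \<epsilon>) z = 0 \<and> cmod (complex_of_real (node lam \<Delta> n) - z) \<le> \<tau> * node lam \<Delta> n"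
    proof (rule prony_root_of_noise_bound[where C = C and R = "\<lambda>m. 2 / \<tau>", OF _ _ adm \<open>l > 1\<close> \<open>M > 0\<close> C \<epsilon>])
      show "inj_on (node lam \<Delta>) {1..N+1}" using nd(1) by (rule inj_on_subset) auto
      show "n \<in> {1..N}" using n by simp
      show "0 < \<tau> * node lam \<Delta> n" using \<tau> nd(3) by simp
      have "(\<Sum>m=1..N. (lagrange_basis \<phi> N m (\<phi> (N+1)))\<^sup>2 * (2 / \<tau>))
          \<le> (\<Sum>m=1..N. geometric_product_bound b ^ 4 * exp (- (b * real (N - m))) * (2 / \<tau>))"
        using \<tau> by (intro sum_mono mult_right_mono L) auto
      also have "\<dots> \<le> C"
        unfolding C_def sum_distrib_right[symmetric]
        using \<tau> sum_lagrange_basis_separated_le[OF b] by (intro mult_right_mono) auto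
      finally show "(\<Sum>m=1..N. (lagrange_basis (node lam \<Delta>) N m (node lam \<Delta> (N+1)))\<^sup>2 * (2 / \<tau>)) \<le> C"
        unfolding \<phi>_def .
      fix z m assume z: "cmod (z - of_real (node lam \<Delta> n)) = \<tau> * node lam \<Delta> n" and m: "m \<in> {1..N}"
      have far: "\<tau> * node lam \<Delta> n \<le> cmod (z - of_real (node lam \<Delta> m))"
      proof (cases "m = n")
        case False
        have "2 * \<tau> \<le> \<bar>node lam \<Delta> m - node lam \<Delta> n\<bar> / node lam \<Delta> n"
          using sep False n m \<Delta> unfolding separation_constant_def by auto
        then have "2 * \<tau> * node lam \<Delta> n \<le> \<bar>node lam \<Delta> m - node lam \<Delta> n\<bar>"
          using nd(3)[of n] by (simp add: field_simps)
        also have "\<dots> = cmod (of_real (node lam \<Delta> m) - of_real (node lam \<Delta> n))"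
          by (metis norm_of_real of_real_diff)
        also have "\<dots> \<le> cmod (z - of_real (node lam \<Delta> n)) + cmod (z - of_real (node lam \<Delta> m))"
          by (metis dist_norm dist_commute dist_triangle2)
        finally show ?thesis using z by simp
      qed (use z in simp)
      have "cmod (z - of_real (node lam \<Delta> (N+1)))
          \<le> cmod (z - of_real (node lam \<Delta> n)) + cmod (of_real (node lam \<Delta> n - node lam \<Delta> (N+1)))"
        using norm_triangle_ineq[of "z - of_real (node lam \<Delta> n)" "of_real (node lam \<Delta> n - node lam \<Delta> (N+1))"] by simp
      also have "\<dots> \<le> \<tau> * node lam \<Delta> n + node lam \<Delta> n"
        using z nd(2)[of n "N+1"] nd(3)[of "N+1"] n unfolding norm_of_real by simp
      also have "\<dots> \<le> 2 * node lam \<Delta> n" using \<tau> nd(3)[of n] by (simp add: mult_le_cancel_right)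
      finally have up: "cmod (z - of_real (node lam \<Delta> (N+1))) \<le> 2 * node lam \<Delta> n" .
      have pos: "\<tau> * node lam \<Delta> n > 0" using \<tau> nd(3) by simp
      have "cmod (z - of_real (node lam \<Delta> (N+1))) / cmod (z - of_real (node lam \<Delta> m))
          \<le> (2 * node lam \<Delta> n) / (\<tau> * node lam \<Delta> n)"
        using up far pos nd(3)[of n] by (intro frac_le) auto
      also have "\<dots> = 2 / \<tau>" using nd(3)[of n] \<tau> by simp
      finally show "z \<noteq> of_real (node lam \<Delta> m) \<and> cmod (z - of_real (node lam \<Delta> (N+1))) / cmod (z - of_real (node lam \<Delta> m)) \<le> 2 / \<tau>"
        using far pos by auto
    qed
    then show ?thesis .
  qed
  moreover have "1 / (2 * M * C) > 0" using C \<open>M > 0\<close> by simp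
  ultimately show ?thesis by blast
qed

text \<open>Here \<open>\<tau>\<close> says nothing about the separation of the nodes, since \<open>T / N\<close> tends to 0: the disc of radius
\<open>\<tau> \<phi>\<^sub>n\<close> may contain many nodes.  It suffices that some smaller circle of comparable radius
is not too close to any node, because the root only has to lie within \<open>\<tau> \<phi>\<^sub>n\<close> of \<open>\<phi>\<^sub>n\<close>.\<close>

theorem prony_root_fixed_horizon:
  fixes lam :: "nat \<Rightarrow> real"
  assumes gap: "\<And>i j. 1 \<le> i \<Longrightarrow> i < j \<Longrightarrow> c * ((real j)\<^sup>2 - (real i)\<^sup>2) \<le> lam j - lam i"
    and "c > 0" "T > 0" "l > 1" "M > 0" and \<tau>: "0 < \<tau>" "\<tau> < 1/2"
  shows "\<exists>\<epsilon>T>0. \<forall>N n. 1 \<le> n \<and> n \<le> N \<longrightarrow>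
            (\<forall>y. admissible_amplitudes l M N y \<longrightarrow> (\<forall>\<epsilon>\<in>{0..\<epsilon>T}.
               \<exists>z. poly (prony_poly lam (T / real N) N y \<epsilon>) z = 0 \<and>
                   cmod (complex_of_real (node lam (T / real N) n) - z)
                     \<le> \<tau> * node lam (T / real N) n))"
proof -
  define \<beta> where "\<beta> = c * T"
  have \<beta>: "\<beta> > 0" unfolding \<beta>_def using assms by simp
  \<comment> \<open>For \<open>m \<ge> N / 2\<close> the gap \<open>\<beta> / N * \<bar>m\<^sup>2 - k\<^sup>2\<bar>\<close> is at least \<open>b * \<bar>m - k\<bar>\<close>.\<close>
  define b where "b = \<beta> / 2"
  have b: "b > 0" unfolding b_def using \<beta> by simp
  \<comment> \<open>A node with \<open>m \<ge> N / 2\<close> has at least the relative distance \<open>\<kappa>\<close> from any other one, so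
    the choice of t keeps it away from the disc of radius \<open>t \<phi>\<^sub>n\<close> around \<open>\<phi>\<^sub>n\<close> unless it is the centre.\<close>
  define \<kappa> where "\<kappa> = 1 - exp (- b)"
  have \<kappa>: "\<kappa> > 0" unfolding \<kappa>_def using b by simp
  define t where "t = min \<tau> (\<kappa> / 2)"
  have t: "t > 0" "t \<le> \<tau>" "2 * t \<le> \<kappa>" unfolding t_def using \<tau> \<kappa> by auto
  define D where "D N = (1 + real N / \<beta>) ^ (2 * N) * exp (- (\<beta> * (real N)\<^sup>2 / 12))" for N
  have D0: "D N \<ge> 0" for N unfolding D_def using \<beta> by simp
  obtain K where K: "\<And>N. (real N)\<^sup>2 * D N \<le> K"
    using crowded_bound_bounded[OF \<beta>] unfolding D_def by blast
  have K0: "K \<ge> 0" using K[of 0] by simp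
  have mono: "lam i < lam j" if "1 \<le> i" "i < j" for i j
  proof -
    have "0 < c * real (j - i)" using that \<open>c > 0\<close> by simp
    then show ?thesis using quadratic_gap_linear[OF \<open>c > 0\<close> that] gap[OF that] by linarith
  qed
  define C where "C = geometric_product_bound b ^ 4 / (1 - exp (- b)) * (4 / t) + K * (16 / t)"
  have C: "C > 0" unfolding C_def geometric_product_bound_def using b t K0 by (intro add_pos_nonneg) auto
  have "\<exists>z. poly (prony_poly lam (T / real N) N y \<epsilon>) z = 0 \<and>
                   cmod (complex_of_real (node lam (T / real N) n) - z) \<le> \<tau> * node lam (T / real N) n"
    if n: "1 \<le> n" "n \<le> N" and adm: "admissible_amplitudes l M N y"
      and \<epsilon>: "\<epsilon> \<in> {0..1 / (2 * M * C)}" for N n y \<epsilon>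
  proof -
    define \<Delta> where "\<Delta> = T / real N"
    have N: "real N \<ge> 1" using n by simp
    have "\<Delta> > 0" unfolding \<Delta>_def using N \<open>T > 0\<close> by simp
    note nd = node_strictly_decreasing[of lam \<Delta>, OF mono \<open>\<Delta> > 0\<close>]
    define \<phi> where "\<phi> = node lam \<Delta>"
    have \<phi>x: "\<phi> = (\<lambda>k. exp (- (lam k * \<Delta>)))" unfolding \<phi>_def node_def by simp
    have \<phi>0: "\<phi> k > 0" for k unfolding \<phi>x by simp
    have xgap: "\<beta> / real N * ((real j)\<^sup>2 - (real i)\<^sup>2) \<le> lam j * \<Delta> - lam i * \<Delta>" if "1 \<le> i" "i < j" for i j
    proof -
      have "\<beta> / real N * ((real j)\<^sup>2 - (real i)\<^sup>2) = (c * ((real j)\<^sup>2 - (real i)\<^sup>2)) * \<Delta>"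
        unfolding \<beta>_def \<Delta>_def by simp
      also have "\<dots> \<le> (lam j - lam i) * \<Delta>"
        using gap[OF that] \<open>\<Delta> > 0\<close> by (intro mult_right_mono) auto
      finally show ?thesis by (simp add: algebra_simps)
    qed
    have xgap': "b * real (j - i) \<le> lam j * \<Delta> - lam i * \<Delta>" if "1 \<le> i" "i < j" "N \<le> 2 * i \<or> N \<le> 2 * j" for i j
    proof -
      have "real N / 2 \<le> real j + real i" using that by auto
      then have "(real N / 2) * real (j - i) \<le> (real j + real i) * (real j - real i)"
        using that by (intro mult_mono) auto
      then have "\<beta> / real N * ((real N / 2) * real (j - i)) \<le> \<beta> / real N * ((real j)\<^sup>2 - (real i)\<^sup>2)"
        using \<beta> N by (intro mult_left_mono) (auto simp: power2_eq_square algebra_simps)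
      moreover have "\<beta> / real N * ((real N / 2) * real (j - i)) = b * real (j - i)"
        unfolding b_def using N by simp
      ultimately show ?thesis using xgap[OF that(1,2)] by linarith
    qed
    have sepn: "\<kappa> * \<phi> n \<le> \<bar>\<phi> m - \<phi> n\<bar>" if m: "m \<in> {1..N}" "N \<le> 2 * m" "m \<noteq> n" for m
    proof -
      have *: "\<kappa> * \<phi> i \<le> \<phi> i - \<phi> j" if "1 \<le> i" "i < j" "N \<le> 2 * i \<or> N \<le> 2 * j" for i j
      proof -
        have "b * 1 \<le> b * real (j - i)" using that b by (intro mult_left_mono) auto
        then have "b \<le> lam j * \<Delta> - lam i * \<Delta>" using xgap'[OF that] by linarith
        then have "\<kappa> \<le> 1 - exp (- (lam j * \<Delta> - lam i * \<Delta>))" unfolding \<kappa>_def by simp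
        moreover have "\<phi> i - \<phi> j = \<phi> i * (1 - exp (- (lam j * \<Delta> - lam i * \<Delta>)))"
          unfolding \<phi>x by (rule exp_diff_factor)
        ultimately show ?thesis using \<phi>0[of i] by (simp add: mult.commute[of \<kappa>])
      qed
      show ?thesis
      proof (cases "m < n")
        case True
        then have "\<kappa> * \<phi> m \<le> \<phi> m - \<phi> n" using *[of m n] m by auto
        moreover have "\<kappa> * \<phi> n \<le> \<kappa> * \<phi> m"
          using \<kappa> nd(2)[of m n] True m unfolding \<phi>_def by (intro mult_left_mono) auto
        ultimately show ?thesis by linarith
      next
        case False
        then have "\<kappa> * \<phi> n \<le> \<phi> n - \<phi> m" using *[of n m] m n by auto
        then show ?thesis by linarith
      qed
    qed
    define S where "S = (\<lambda>m. \<bar>\<phi> m - \<phi> n\<bar>) ` {1..N}"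
    have "card S \<le> N" unfolding S_def using card_image_le[of "{1..N}"] by simp
    \<comment> \<open>The lower half of the interval is excluded so that the centre stays at a distance
      proportional to \<open>\<phi>\<^sub>n\<close> without a factor \<open>1 / N\<close>.\<close>
    then obtain \<rho> where \<rho>: "t * \<phi> n / 2 \<le> \<rho>" "\<rho> \<le> t * \<phi> n"
      "\<And>s. s \<in> S \<Longrightarrow> (t * \<phi> n - t * \<phi> n / 2) / (2 * (real N + 1)) \<le> \<bar>\<rho> - s\<bar>"
      using exists_point_away_from_finite_set[of "t * \<phi> n / 2" "t * \<phi> n" S N] t(1) \<phi>0[of n]
      unfolding S_def by auto
    define h where "h = t * \<phi> n / (8 * real N)"
    have h: "h > 0" unfolding h_def using t \<phi>0 N by simp
    have far: "h \<le> cmod (z - of_real (\<phi> m))" if "cmod (z - of_real (\<phi> n)) = \<rho>" "m \<in> {1..N}" for z m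
    proof -
      have "h \<le> (t * \<phi> n / 2) / (2 * (real N + 1))"
        unfolding h_def using N t(1) \<phi>0[of n] by (simp add: field_simps)
      also have "\<dots> \<le> \<bar>\<rho> - \<bar>\<phi> m - \<phi> n\<bar>\<bar>" using \<rho>(3)[of "\<bar>\<phi> m - \<phi> n\<bar>"] that(2) unfolding S_def by auto
      also have "\<bar>\<phi> m - \<phi> n\<bar> = cmod (of_real (\<phi> m) - of_real (\<phi> n))"
        by (metis norm_of_real of_real_diff)
      also have "\<bar>\<rho> - \<dots>\<bar> \<le> cmod (z - of_real (\<phi> m))"
        using that(1) norm_triangle_ineq3[of "z - of_real (\<phi> n)" "of_real (\<phi> m) - of_real (\<phi> n)"] by simp
      finally show ?thesis .
    qed
    have near: "t / 2 * \<phi> n \<le> cmod (z - of_real (\<phi> m))"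
      if "cmod (z - of_real (\<phi> n)) = \<rho>" "m \<in> {1..N}" "N \<le> 2 * m" for z m
    proof (cases "m = n")
      case True
      then show ?thesis using that \<rho>(1) by simp
    next
      case False
      have "2 * t * \<phi> n \<le> \<kappa> * \<phi> n" using t(3) \<phi>0[of n] by (intro mult_right_mono) auto
      also have "\<dots> \<le> \<bar>\<phi> m - \<phi> n\<bar>" using sepn that False by blast
      also have "\<dots> = cmod (of_real (\<phi> m) - of_real (\<phi> n))"
        by (metis norm_of_real of_real_diff)
      also have "\<dots> \<le> cmod (z - of_real (\<phi> n)) + cmod (z - of_real (\<phi> m))"
        by (metis dist_norm dist_commute dist_triangle2)
      finally have "t * \<phi> n \<le> cmod (z - of_real (\<phi> m))" using that(1) \<rho>(2) by simp
      moreover have "t / 2 * \<phi> n \<le> t * \<phi> n" using t \<phi>0[of n] by simp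
      ultimately show ?thesis by linarith
    qed
    \<comment> \<open>The bound that grows with N only occurs for \<open>m < N / 2\<close>, where the basis polynomials are tiny.\<close>
    define R where "R m = (if N \<le> 2 * m then 4 / t else 16 * real N / t)" for m
    have "\<exists>z. poly (prony_poly lam \<Delta> N y \<epsilon>) z = 0 \<and> cmod (complex_of_real (node lam \<Delta> n) - z) \<le> \<rho>"
    proof (rule prony_root_of_noise_bound[where C = C and R = R, OF _ _ adm \<open>l > 1\<close> \<open>M > 0\<close> C \<epsilon>])
      show "inj_on (node lam \<Delta>) {1..N+1}" using nd(1) by (rule inj_on_subset) auto
      show "n \<in> {1..N}" using n by simp
      show "0 < \<rho>" using \<rho>(1) t(1) \<phi>0[of n] by (meson half_gt_zero less_le_trans mult_pos_pos)
      have "(\<Sum>m=1..N. (lagrange_basis \<phi> N m (\<phi> (N+1)))\<^sup>2 * R m)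
          \<le> (\<Sum>m=1..N. geometric_product_bound b ^ 4 * exp (- (b * real (N - m))) * (4 / t) + D N * (16 * real N / t))"
      proof (rule sum_mono)
        fix m assume m: "m \<in> {1..N}"
        show "(lagrange_basis \<phi> N m (\<phi> (N+1)))\<^sup>2 * R m
            \<le> geometric_product_bound b ^ 4 * exp (- (b * real (N - m))) * (4 / t) + D N * (16 * real N / t)"
        proof (cases "N \<le> 2 * m")
          case True
          have "(lagrange_basis \<phi> N m (\<phi> (N+1)))\<^sup>2 \<le> geometric_product_bound b ^ 4 * exp (- (b * real (N - m)))"
            unfolding \<phi>x
            by (rule lagrange_basis_separated) (use m b xgap' True mono \<open>\<Delta> > 0\<close> in auto)
          then have "(lagrange_basis \<phi> N m (\<phi> (N+1)))\<^sup>2 * R m \<le> geometric_product_bound b ^ 4 * exp (- (b * real (N - m))) * (4 / t)"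
            unfolding R_def using True t by (simp only: if_True) (intro mult_right_mono, auto)
          moreover have "0 \<le> D N * (16 * real N / t)" using D0 t by simp
          ultimately show ?thesis by linarith
        next
          case False
          have "(lagrange_basis \<phi> N m (\<phi> (N+1)))\<^sup>2 \<le> D N"
            unfolding \<phi>x D_def
            by (rule lagrange_basis_crowded) (use m \<beta> xgap False in auto)
          then have "(lagrange_basis \<phi> N m (\<phi> (N+1)))\<^sup>2 * R m \<le> D N * (16 * real N / t)"
            unfolding R_def using False t by (simp only: if_False) (intro mult_right_mono, auto)
          moreover have "0 \<le> geometric_product_bound b ^ 4 * exp (- (b * real (N - m))) * (4 / t)"
            unfolding geometric_product_bound_def using t by simp
          ultimately show ?thesis by linarith
        qed
      qed
      also have "\<dots> = (\<Sum>m=1..N. geometric_product_bound b ^ 4 * exp (- (b * real (N - m)))) * (4 / t)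
            + ((real N)\<^sup>2 * D N) * (16 / t)"
        unfolding sum.distrib sum_distrib_right[symmetric] by (simp add: power2_eq_square)
      also have "\<dots> \<le> C"
        unfolding C_def
        using t sum_lagrange_basis_separated_le[OF b] K by (intro add_mono mult_right_mono) auto
      finally show "(\<Sum>m=1..N. (lagrange_basis (node lam \<Delta>) N m (node lam \<Delta> (N+1)))\<^sup>2 * R m) \<le> C"
        unfolding \<phi>_def .
      fix z m assume z: "cmod (z - of_real (node lam \<Delta> n)) = \<rho>" and m: "m \<in> {1..N}"
      have z': "cmod (z - of_real (\<phi> n)) = \<rho>" using z unfolding \<phi>_def .
      have "cmod (z - of_real (\<phi> (N+1))) \<le> cmod (z - of_real (\<phi> n)) + cmod (of_real (\<phi> n - \<phi> (N+1)))"
        using norm_triangle_ineq[of "z - of_real (\<phi> n)" "of_real (\<phi> n - \<phi> (N+1))"] by simp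
      also have "\<dots> \<le> t * \<phi> n + \<phi> n"
        using z' \<rho>(2) nd(2)[of n "N+1"] \<phi>0[of "N+1"] n unfolding norm_of_real \<phi>_def by simp
      also have "\<dots> \<le> 2 * \<phi> n"
        using \<tau> t(2) \<phi>0[of n] by (simp add: mult_le_cancel_right)
      finally have up: "cmod (z - of_real (\<phi> (N+1))) \<le> 2 * \<phi> n" .
      have "cmod (z - of_real (\<phi> (N+1))) / cmod (z - of_real (\<phi> m)) \<le> R m"
      proof (cases "N \<le> 2 * m")
        case True
        have "cmod (z - of_real (\<phi> (N+1))) / cmod (z - of_real (\<phi> m)) \<le> (2 * \<phi> n) / (t / 2 * \<phi> n)"
          using up near[OF z' m True] t(1) \<phi>0[of n] by (intro frac_le) auto
        also have "\<dots> = 4 / t" using \<phi>0[of n] by simp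
        finally show ?thesis unfolding R_def using True by simp
      next
        case False
        have "cmod (z - of_real (\<phi> (N+1))) / cmod (z - of_real (\<phi> m)) \<le> (2 * \<phi> n) / h"
          using up far[OF z' m] h \<phi>0[of n] by (intro frac_le) auto
        also have "\<dots> = 16 * real N / t" unfolding h_def using \<phi>0[of n] by simp
        finally show ?thesis unfolding R_def using False by simp
      qed
      moreover have "z \<noteq> of_real (\<phi> m)" using far[OF z' m] h by auto
      ultimately show "z \<noteq> of_real (node lam \<Delta> m) \<and> cmod (z - of_real (node lam \<Delta> (N+1))) / cmod (z - of_real (node lam \<Delta> m)) \<le> R m"
        unfolding \<phi>_def by blast
    qed
    moreover have "\<rho> \<le> \<tau> * node lam \<Delta> n"
    proof -
      have "\<rho> \<le> t * \<phi> n" by (rule \<rho>(2))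
      also have "\<dots> \<le> \<tau> * \<phi> n" using t(2) \<phi>0[of n] by (intro mult_right_mono) auto
      finally show ?thesis unfolding \<phi>_def .
    qed
    ultimately show ?thesis unfolding \<Delta>_def by (meson order.trans)
  qed
  moreover have "1 / (2 * M * C) > 0" using C \<open>M > 0\<close> by simp
  ultimately show ?thesis by blast
qed

section \<open>Weak derivatives on the unit interval\<close>

definition test_function :: "(real \<Rightarrow> real) \<Rightarrow> (real \<Rightarrow> real) \<Rightarrow> bool" where
  "test_function \<psi> \<psi>' \<longleftrightarrow> (\<forall>x. (\<psi> has_real_derivative \<psi>' x) (at x)) \<and> continuous_on UNIV \<psi>' \<and>
     (\<exists>K. compact K \<and> K \<subseteq> {0<..<1} \<and> (\<forall>x. x \<notin> K \<longrightarrow> \<psi> x = 0))"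

lemma weak_deriv_of_iff:
  "weak_deriv_of f g \<longleftrightarrow> (\<forall>\<psi> \<psi>'. test_function \<psi> \<psi>' \<longrightarrow>
     (LINT x|unit_measure. f x * \<psi>' x) = - (LINT x|unit_measure. g x * \<psi> x))"
  unfolding weak_deriv_of_def test_function_def by blast

lemma finite_unit_measure: "finite_measure unit_measure"
  by (rule finite_measureI) (simp add: emeasure_restrict_space)

lemma space_unit: "space unit_measure = {0<..<1}"
  by (simp add: space_restrict_space)

lemma continuous_unit_bounded_measurable:
  assumes "continuous_on {0..1} (f :: real \<Rightarrow> real)"
  shows "f \<in> borel_measurable unit_measure" and "\<exists>B. \<forall>x\<in>{0..1}. \<bar>f x\<bar> \<le> B"
proof -
  show "f \<in> borel_measurable unit_measure"
    by (rule continuous_imp_measurable_on_sets_lebesgue)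
       (use assms in \<open>auto intro: continuous_on_subset\<close>)
  have "bounded (f ` {0..1})" using assms by (intro compact_imp_bounded compact_continuous_image) auto
  then show "\<exists>B. \<forall>x\<in>{0..1}. \<bar>f x\<bar> \<le> B" unfolding bounded_iff by auto
qed

lemma integrable_mult_continuous_unit:
  assumes "integrable unit_measure g" "continuous_on {0..1} (f :: real \<Rightarrow> real)"
  shows "integrable unit_measure (\<lambda>x. g x * f x)"
proof -
  note m = continuous_unit_bounded_measurable[OF assms(2)]
  obtain B where B: "\<And>x. x \<in> {0..1} \<Longrightarrow> \<bar>f x\<bar> \<le> B" using m(2) by blast
  show ?thesis
  proof (rule Bochner_Integration.integrable_bound)
    show "integrable unit_measure (\<lambda>x. B * g x)" using assms(1) by simp
    show "(\<lambda>x. g x * f x) \<in> borel_measurable unit_measure"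
      using assms(1) m(1) by (intro borel_measurable_times) auto
    show "AE x in unit_measure. norm (g x * f x) \<le> norm (B * g x)"
    proof (rule AE_I2)
      fix x assume "x \<in> space unit_measure"
      then have "\<bar>f x\<bar> \<le> \<bar>B\<bar>" using B[of x] by (simp add: space_unit)
      then show "norm (g x * f x) \<le> norm (B * g x)"
        by (simp add: abs_mult mult.commute[of "\<bar>g x\<bar>"] mult_right_mono)
    qed
  qed
qed

lemma integrable_unit_const: "integrable unit_measure (\<lambda>x. c :: real)"
  using finite_measure.integrable_const[OF finite_unit_measure] .

lemma integrable_continuous_unit:
  assumes "continuous_on {0..1} (f :: real \<Rightarrow> real)"
  shows "integrable unit_measure f"
  using integrable_mult_continuous_unit[OF integrable_unit_const[of 1] assms] by simp

lemma L2_unit_integrable: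
  assumes "f \<in> L2_unit"
  shows "integrable unit_measure f"
proof (rule Bochner_Integration.integrable_bound)
  show "integrable unit_measure (\<lambda>x. 1 + (f x)\<^sup>2)"
    using assms integrable_unit_const by (auto simp: L2_unit_def)
  show "f \<in> borel_measurable unit_measure" using assms by (simp add: L2_unit_def)
  have "\<bar>t\<bar> \<le> 1 + t\<^sup>2" for t :: real
  proof -
    have "0 \<le> (\<bar>t\<bar> - 1)\<^sup>2" by simp
    then show ?thesis by (simp add: power2_eq_square algebra_simps abs_if split: if_splits)
  qed
  then show "AE x in unit_measure. norm (f x) \<le> norm (1 + (f x)\<^sup>2)" by auto
qed

lemma L2_unit_add:
  assumes "f \<in> L2_unit" "g \<in> L2_unit"
  shows "(\<lambda>x. f x + g x) \<in> L2_unit"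
proof -
  have m: "f \<in> borel_measurable unit_measure" "g \<in> borel_measurable unit_measure"
    using assms by (auto simp: L2_unit_def)
  have "integrable unit_measure (\<lambda>x. (f x + g x)\<^sup>2)"
  proof (rule Bochner_Integration.integrable_bound)
    show "integrable unit_measure (\<lambda>x. 2 * (f x)\<^sup>2 + 2 * (g x)\<^sup>2)"
      using assms by (auto simp: L2_unit_def)
    show "(\<lambda>x. (f x + g x)\<^sup>2) \<in> borel_measurable unit_measure" using m by measurable
    have "(a + b)\<^sup>2 \<le> 2 * a\<^sup>2 + 2 * b\<^sup>2" for a b :: real
      using zero_le_power2[of "a - b"] by (simp add: power2_eq_square algebra_simps)
    then show "AE x in unit_measure. norm ((f x + g x)\<^sup>2) \<le> norm (2 * (f x)\<^sup>2 + 2 * (g x)\<^sup>2)"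
      by auto
  qed
  then show ?thesis using m by (simp add: L2_unit_def)
qed

lemma L2_unit_mult_continuous:
  assumes "g \<in> L2_unit" "continuous_on {0..1} f"
  shows "(\<lambda>x. f x * g x) \<in> L2_unit"
proof -
  have m: "g \<in> borel_measurable unit_measure" "f \<in> borel_measurable unit_measure"
    using assms continuous_unit_bounded_measurable by (auto simp: L2_unit_def)
  have "integrable unit_measure (\<lambda>x. (g x)\<^sup>2 * (f x)\<^sup>2)"
    using assms by (intro integrable_mult_continuous_unit continuous_intros) (auto simp: L2_unit_def)
  then show ?thesis using m by (simp add: L2_unit_def power_mult_distrib mult.commute)
qed

lemma test_function_continuous:
  assumes "test_function \<psi> \<psi>'"
  shows "continuous_on A \<psi>" "continuous_on A \<psi>'"
proof -
  show "continuous_on A \<psi>"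
    using assms unfolding test_function_def
    by (meson DERIV_isCont continuous_at_imp_continuous_on)
  show "continuous_on A \<psi>'"
    using assms unfolding test_function_def by (meson continuous_on_subset subset_UNIV)
qed

lemma test_function_deriv_outside:
  assumes der: "\<And>x. (\<psi> has_real_derivative \<psi>' x) (at x)" and "closed K"
    and zero: "\<And>x. x \<notin> K \<Longrightarrow> \<psi> x = 0" and "x \<notin> K"
  shows "\<psi>' x = 0"
proof -
  have "((\<lambda>x. 0) has_real_derivative \<psi>' x) (at x)"
    by (rule has_field_derivative_transform_within_open[OF der[of x], of "- K"])
       (use assms in auto)
  then show ?thesis using DERIV_unique DERIV_const by blast
qed

lemma deriv_max_square:
  "((\<lambda>t::real. (max 0 t)\<^sup>2) has_real_derivative 2 * max 0 t) (at t)"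
proof -
  consider "t > 0" | "t < 0" | "t = 0" by linarith
  then show ?thesis
  proof cases
    case 1
    have "((\<lambda>t. t\<^sup>2) has_real_derivative 2 * t) (at t)" by (auto intro!: derivative_eq_intros)
    then have "((\<lambda>t. (max 0 t)\<^sup>2) has_real_derivative 2 * t) (at t)"
      by (rule has_field_derivative_transform_within_open[where S = "{0<..}"]) (use 1 in auto)
    then show ?thesis using 1 by simp
  next
    case 2
    have "((\<lambda>t. 0) has_real_derivative 0) (at t)" by simp
    then have "((\<lambda>t. (max 0 t)\<^sup>2) has_real_derivative 0) (at t)"
      by (rule has_field_derivative_transform_within_open[where S = "{..<0}"]) (use 2 in auto)
    then show ?thesis using 2 by simp
  next
    case 3
    have "((\<lambda>h::real. max 0 h) \<longlongrightarrow> max 0 0) (at 0)" by (intro tendsto_intros)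
    moreover have "\<forall>\<^sub>F h in at 0. max 0 h = ((max 0 (0 + h))\<^sup>2 - (max 0 0)\<^sup>2) / (h::real)"
      unfolding eventually_at_filter by (auto simp: max_def power2_eq_square)
    ultimately have "((\<lambda>h::real. ((max 0 (0 + h))\<^sup>2 - (max 0 0)\<^sup>2) / h) \<longlongrightarrow> max 0 0) (at 0)"
      by (rule Lim_transform_eventually)
    then show ?thesis unfolding DERIV_def using 3 by simp
  qed
qed

text \<open>For \<open>c > 0\<close> this is a function of class C1 that is positive exactly on the open interval from \<open>a\<close> to \<open>b\<close> and
tends to its indicator as \<open>c\<close> grows.\<close>

definition bump :: "real \<Rightarrow> real \<Rightarrow> real \<Rightarrow> real \<Rightarrow> real" where
  "bump c a b x = 1 - 1 / (1 + c * ((max 0 (x - a))\<^sup>2 * (max 0 (b - x))\<^sup>2))"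

lemma bump_test_function:
  assumes "0 < a" "b < 1" "c \<ge> 0"
  shows "\<exists>\<psi>'. test_function (bump c a b) \<psi>'"
proof -
  define \<beta> where "\<beta> x = (max 0 (x - a))\<^sup>2 * (max 0 (b - x))\<^sup>2" for x
  define \<beta>' where "\<beta>' x = 2 * max 0 (x - a) * (max 0 (b - x))\<^sup>2 - (max 0 (x - a))\<^sup>2 * (2 * max 0 (b - x))" for x
  have 1: "((\<lambda>x. (max 0 (x - a))\<^sup>2) has_real_derivative 2 * max 0 (x - a)) (at x)" for x
  proof -
    have "((\<lambda>x. x - a) has_real_derivative 1) (at x)" by (auto intro!: derivative_eq_intros)
    from DERIV_chain2[where f = "\<lambda>t. (max 0 t)\<^sup>2" and g = "\<lambda>x. x - a", OF deriv_max_square this]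
    show ?thesis by simp
  qed
  have 2: "((\<lambda>x. (max 0 (b - x))\<^sup>2) has_real_derivative - (2 * max 0 (b - x))) (at x)" for x
  proof -
    have "((\<lambda>x. b - x) has_real_derivative - 1) (at x)" by (auto intro!: derivative_eq_intros)
    from DERIV_chain2[where f = "\<lambda>t. (max 0 t)\<^sup>2" and g = "\<lambda>x. b - x", OF deriv_max_square this]
    show ?thesis by simp
  qed
  have \<beta>: "(\<beta> has_real_derivative \<beta>' x) (at x)" for x
    unfolding \<beta>_def[abs_def] \<beta>'_def
    by (rule derivative_eq_intros 1 2 refl)+ (simp add: algebra_simps)
  have pos: "1 + c * \<beta> x > 0" for x unfolding \<beta>_def using assms(3) by (simp add: add_pos_nonneg)
  define \<psi>' where "\<psi>' x = c * \<beta>' x / (1 + c * \<beta> x)\<^sup>2" for x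
  have "(bump c a b has_real_derivative \<psi>' x) (at x)" for x
    unfolding bump_def[abs_def] \<beta>_def[symmetric] \<psi>'_def
    by (rule derivative_eq_intros \<beta> refl)+
       (use pos[of x] in \<open>auto simp: power2_eq_square\<close>)
  moreover have "continuous_on UNIV \<psi>'"
    unfolding \<psi>'_def[abs_def] \<beta>_def[abs_def] \<beta>'_def[abs_def]
    by (intro continuous_intros) (use pos in \<open>auto simp: \<beta>_def less_imp_neq[symmetric]\<close>)
  moreover have "\<forall>x. x \<notin> {a..b} \<longrightarrow> bump c a b x = 0"
    unfolding bump_def by (auto simp: not_le max_def)
  ultimately show ?thesis
    unfolding test_function_def using assms by (intro exI[of _ \<psi>'] conjI allI exI[of _ "{a..b}"]) auto
qed

lemma bump_bounds: "c \<ge> 0 \<Longrightarrow> 0 \<le> bump c a b x \<and> bump c a b x \<le> 1"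
  unfolding bump_def by (simp add: divide_le_eq)

text \<open>The end points move with \<open>n\<close> so that each approximant has compact support in the open unit interval, although
the limit interval may reach or exceed its ends.\<close>

lemma bump_tendsto_indicator:
  assumes x: "x \<in> {0<..<1}"
  shows "(\<lambda>n. bump (real n) (max a (1 / (real n + 1))) (min b (1 - 1 / (real n + 1))) x)
     \<longlonglongrightarrow> indicator {a<..<b} x"
proof -
  define \<beta> where "\<beta> n = (max 0 (x - max a (1 / (real n + 1))))\<^sup>2 * (max 0 (min b (1 - 1 / (real n + 1)) - x))\<^sup>2" for n :: nat
  have i: "(\<lambda>n. 1 / (real n + 1)) \<longlonglongrightarrow> 0"
    using LIMSEQ_inverse_real_of_nat by (simp add: inverse_eq_divide add.commute)
  have lim: "\<beta> \<longlonglongrightarrow> (max 0 (x - max a 0))\<^sup>2 * (max 0 (min b (1 - 0) - x))\<^sup>2"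
    unfolding \<beta>_def[abs_def] by (intro tendsto_intros i)
  show ?thesis
  proof (cases "x \<in> {a<..<b}")
    case True
    have "(max 0 (x - max a 0))\<^sup>2 * (max 0 (min b (1 - 0) - x))\<^sup>2 > 0"
      using True x by auto
    then have "filterlim (\<lambda>n. \<beta> n * real n) at_top sequentially"
      by (rule filterlim_tendsto_pos_mult_at_top[OF lim _ filterlim_real_sequentially])
    then have "filterlim (\<lambda>n. 1 + \<beta> n * real n) at_top sequentially"
      by (rule filterlim_tendsto_add_at_top[OF tendsto_const])
    then have "(\<lambda>n. 1 / (1 + \<beta> n * real n)) \<longlonglongrightarrow> 0"
      by (rule real_tendsto_divide_at_top[OF tendsto_const])
    then have "(\<lambda>n. 1 - 1 / (1 + \<beta> n * real n)) \<longlonglongrightarrow> 1 - 0"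
      by (intro tendsto_intros)
    then show ?thesis using True unfolding bump_def \<beta>_def by (simp add: mult.commute)
  next
    case False
    then have "\<beta> n = 0" for n unfolding \<beta>_def by (auto simp: max_def min_def)
    then show ?thesis using False unfolding bump_def \<beta>_def[symmetric] by simp
  qed
qed

lemma integral_interval_zero_of_test_functions:
  assumes g: "integrable unit_measure g"
    and zero: "\<And>\<psi> \<psi>'. test_function \<psi> \<psi>' \<Longrightarrow> (LINT x|unit_measure. g x * \<psi> x) = 0"
  shows "(LINT x|unit_measure. g x * indicator {a<..<b} x) = 0"
proof -
  define \<psi> where "\<psi> n = bump (real n) (max a (1 / (real n + 1))) (min b (1 - 1 / (real n + 1)))" for n :: nat
  have tf: "\<exists>\<psi>'. test_function (\<psi> n) \<psi>'" for n
    unfolding \<psi>_def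
  proof (rule bump_test_function)
    have "0 < 1 / (real n + 1)" by simp
    then show "0 < max a (1 / (real n + 1))" "min b (1 - 1 / (real n + 1)) < 1" by linarith+
  qed simp
  have "(\<lambda>n. LINT x|unit_measure. g x * \<psi> n x) \<longlonglongrightarrow> (LINT x|unit_measure. g x * indicator {a<..<b} x)"
  proof (rule integral_dominated_convergence[where w = "\<lambda>x. \<bar>g x\<bar>"])
    have m: "g \<in> borel_measurable unit_measure" using g by auto
    have "indicator {a<..<b} \<in> borel_measurable unit_measure"
      by (intro measurable_restrict_space1 borel_measurable_indicator) auto
    then show "(\<lambda>x. g x * indicator {a<..<b} x) \<in> borel_measurable unit_measure"
      using m by (intro borel_measurable_times)
    show "(\<lambda>x. g x * \<psi> n x) \<in> borel_measurable unit_measure" for n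
      using tf[of n] m continuous_unit_bounded_measurable(1) test_function_continuous(1)
      by (intro borel_measurable_times) blast+
    show "integrable unit_measure (\<lambda>x. \<bar>g x\<bar>)" using g by simp
    show "AE x in unit_measure. (\<lambda>n. g x * \<psi> n x) \<longlonglongrightarrow> g x * indicator {a<..<b} x"
      unfolding \<psi>_def by (intro AE_I2 tendsto_intros bump_tendsto_indicator) (simp add: space_unit)
    show "AE x in unit_measure. norm (g x * \<psi> n x) \<le> \<bar>g x\<bar>" for n
      unfolding \<psi>_def using bump_bounds[of "real n"] by (auto simp: abs_mult intro!: AE_I2 mult_left_le)
  qed
  moreover have "(LINT x|unit_measure. g x * \<psi> n x) = 0" for n using tf[of n] zero by blast
  ultimately show ?thesis by (simp add: LIMSEQ_const_iff)
qed

text \<open>The set function \<open>A \<mapsto> \<integral>\<^sub>A g\<close> vanishes on intervals, hence on Borel sets, hence on Lebesgue sets, which are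
Borel up to null sets.\<close>

lemma AE_zero_of_test_functions:
  assumes g: "integrable unit_measure g"
    and zero: "\<And>\<psi> \<psi>'. test_function \<psi> \<psi>' \<Longrightarrow> (LINT x|unit_measure. g x * \<psi> x) = 0"
  shows "AE x in unit_measure. g x = 0"
proof (rule density_unique_real[OF g integrable_unit_const[of 0]])
  define I where "I A = (LINT x:A|lebesgue. indicator {0<..<1} x * g x)" for A
  have gl: "integrable lebesgue (\<lambda>x. indicator {0<..<1} x * g x)"
    using g by (simp add: integrable_restrict_space)
  have I: "I A = (LINT x|unit_measure. g x * indicator A x)" for A
    unfolding I_def set_lebesgue_integral_def
    by (simp add: integral_restrict_space mult_ac)
  have iv: "I {a<..<b} = 0" for a b
    unfolding I using integral_interval_zero_of_test_functions[OF g zero] .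
  have si: "set_integrable lebesgue A (\<lambda>x. indicator {0<..<1} x * g x)" if "A \<in> sets borel" for A
    unfolding set_integrable_def using gl that by (intro integrable_mult_indicator) auto
  have all: "I UNIV = 0"
  proof -
    have "I UNIV = I {0<..<1}" unfolding I
      by (intro Bochner_Integration.integral_cong refl) (simp add: space_unit)
    then show ?thesis using iv by simp
  qed
  have gm: "set_borel_measurable lebesgue A (\<lambda>x. indicator {0<..<1} x * g x)" if "A \<in> sets lebesgue" for A
    unfolding set_borel_measurable_def using gl that
    by (intro borel_measurable_scaleR borel_measurable_indicator) auto
  have null: "I A = I B" if "A \<in> sets lebesgue" "B \<in> sets lebesgue" "negligible N" "\<And>x. x \<notin> N \<Longrightarrow> x \<in> A \<longleftrightarrow> x \<in> B" for A B N
    unfolding I_def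
  proof (rule set_integral_cong_set[OF gm[OF that(2)] gm[OF that(1)]])
    have "AE x in lebesgue. x \<notin> N" using that(3) negligible_iff_null_sets AE_not_in by blast
    then show "AE x in lebesgue. (x \<in> B) = (x \<in> A)" by eventually_elim (use that(4) in auto)
  qed
  have borel: "I B = 0" if "B \<in> sets borel" for B
    using that
  proof (induction rule: borel_set_induct)
    case empty
    show ?case unfolding I_def set_lebesgue_integral_def by simp
  next
    case (interval a b)
    have "I {a..b} = I {a<..<b}"
      by (rule null[of _ _ "{a, b}"]) auto
    then show ?case using iv by simp
  next
    case (compl A)
    have "I (A \<union> - A) = I A + I (- A)"
      unfolding I_def using compl by (intro set_integral_Un si) auto
    then show ?case using all compl by simp
  next
    case (union A)
    have "I (\<Union>i. A i) = (\<Sum>i. I (A i))"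
      unfolding I_def
    proof (rule lebesgue_integral_countable_add)
      show "set_integrable lebesgue (\<Union>i. A i) (\<lambda>x. indicator {0<..<1} x * g x)"
        using union by (intro si) auto
    qed (use union in \<open>auto simp: disjoint_family_on_def\<close>)
    then show ?case using union by simp
  qed
  fix A assume "A \<in> sets unit_measure"
  then have "A \<in> sets lebesgue" "A \<subseteq> {0<..<1}"
    by (auto simp: sets_restrict_space)
  then obtain B N where BN: "B \<in> sets borel" "negligible N" "B \<union> N = A"
    using sets_lebesgue_almost_borel by metis
  have "(LINT x:A|unit_measure. g x) = I A"
    unfolding I set_lebesgue_integral_def by (simp add: mult.commute)
  also have "\<dots> = I B"
    by (rule null[of _ _ N]) (use BN \<open>A \<in> sets lebesgue\<close> in auto)
  also have "\<dots> = 0" by (rule borel[OF BN(1)])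
  finally show "(LINT x:A|unit_measure. g x) = (LINT x:A|unit_measure. 0)"
    by (simp add: set_lebesgue_integral_def)
qed

lemma unit_integral_derivative:
  assumes der: "\<And>x. x \<in> {0..1} \<Longrightarrow> (F has_real_derivative f x) (at x within {0..1})"
    and cont: "continuous_on {0..1} f"
  shows "(LINT x|unit_measure. f x) = F 1 - F 0"
proof -
  have "(LINT x|unit_measure. f x) = integral {0<..<1} f"
    by (rule lebesgue_integral_eq_integral[OF integrable_continuous_unit[OF cont]]) simp
  also have "\<dots> = integral {0..1} f" by (rule integral_open_interval_real[symmetric])
  also have "\<dots> = F 1 - F 0"
    by (intro integral_unique fundamental_theorem_of_calculus)
       (use der in \<open>auto simp: has_real_derivative_iff_has_vector_derivative\<close>)
  finally show ?thesis .
qed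

lemma test_function_endpoints:
  assumes "test_function \<psi> \<psi>'"
  shows "\<psi> 0 = 0" "\<psi> 1 = 0"
proof -
  obtain K where K: "K \<subseteq> {0<..<1}" "\<And>x. x \<notin> K \<Longrightarrow> \<psi> x = 0"
    using assms unfolding test_function_def by blast
  show "\<psi> 0 = 0" "\<psi> 1 = 0" using K by (meson greaterThanLessThan_iff less_irrefl subsetD)+
qed

text \<open>A primitive of \<open>\<zeta>\<close> that vanishes at 0 is constant on each side of the support of \<open>\<zeta>\<close>, and its value at 1 is
the mean of \<open>\<zeta>\<close>.\<close>

lemma mean_zero_test_function_primitive:
  assumes cont: "continuous_on UNIV \<zeta>" and K: "compact K" "K \<subseteq> {0<..<1}" "\<And>x. x \<notin> K \<Longrightarrow> \<zeta> x = 0"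
    and mean: "(LINT x|unit_measure. \<zeta> x) = 0"
  shows "\<exists>\<psi>. test_function \<psi> \<zeta>"
proof -
  have "\<exists>F. \<forall>x::real. -\<infinity> < ereal x \<longrightarrow> ereal x < \<infinity> \<longrightarrow> (F has_vector_derivative \<zeta> x) (at x)"
    by (rule einterval_antiderivative) (use cont in \<open>auto simp: continuous_on_eq_continuous_at\<close>)
  then obtain F where "\<And>x. (F has_real_derivative \<zeta> x) (at x)"
    by (auto simp: has_real_derivative_iff_has_vector_derivative)
  note F = this
  define \<psi> where "\<psi> x = F x - F 0" for x
  have der: "(\<psi> has_real_derivative \<zeta> x) (at x)" for x
    unfolding \<psi>_def[abs_def] by (auto intro!: derivative_eq_intros F)
  have \<psi>0: "\<psi> 0 = 0" unfolding \<psi>_def by simp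
  have "(LINT x|unit_measure. \<zeta> x) = \<psi> 1 - \<psi> 0"
    by (rule unit_integral_derivative)
       (use der cont in \<open>auto intro: has_field_derivative_at_within continuous_on_subset\<close>)
  then have \<psi>1: "\<psi> 1 = 0" using mean \<psi>0 by simp
  \<comment> \<open>The midpoint only ensures that the set has a least and a greatest element.\<close>
  define K' where "K' = insert (1/2) K"
  have K': "compact K'" "K' \<noteq> {}" "K' \<subseteq> {0<..<1}" unfolding K'_def using K by auto
  obtain a where a: "a \<in> K'" "\<And>x. x \<in> K' \<Longrightarrow> a \<le> x" using compact_attains_inf[OF K'(1,2)] by blast
  obtain b where b: "b \<in> K'" "\<And>x. x \<in> K' \<Longrightarrow> x \<le> b" using compact_attains_sup[OF K'(1,2)] by blast
  have ab: "0 < a" "b < 1" using a b K'(3) by auto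
  have left: "\<psi> x = 0" if "x < a" for x
  proof -
    have "\<exists>c. \<forall>x\<in>{..<a}. \<psi> x = c"
    proof (rule has_field_derivative_zero_constant)
      fix t assume t: "t \<in> {..<a}"
      then have "\<zeta> t = 0" using K(3) a(2)[of t] unfolding K'_def by fastforce
      then show "(\<psi> has_real_derivative 0) (at t within {..<a})"
        using der[of t] by (metis has_field_derivative_at_within)
    qed (rule convex_real_interval)
    then show ?thesis using that ab(1) \<psi>0 by (metis lessThan_iff)
  qed
  have right: "\<psi> x = 0" if "b < x" for x
  proof -
    have "\<exists>c. \<forall>x\<in>{b<..}. \<psi> x = c"
    proof (rule has_field_derivative_zero_constant)
      fix t assume t: "t \<in> {b<..}"
      then have "\<zeta> t = 0" using K(3) b(2)[of t] unfolding K'_def by fastforce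
      then show "(\<psi> has_real_derivative 0) (at t within {b<..})"
        using der[of t] by (metis has_field_derivative_at_within)
    qed (rule convex_real_interval)
    then show ?thesis using that ab(2) \<psi>1 by (metis greaterThan_iff)
  qed
  have "\<forall>x. x \<notin> {a..b} \<longrightarrow> \<psi> x = 0" using left right by (auto simp: not_le)
  moreover have "{a..b} \<subseteq> {0<..<1}" using ab by auto
  ultimately show ?thesis
    unfolding test_function_def using der cont by (intro exI[of _ \<psi>]) (auto intro: exI[of _ "{a..b}"])
qed

text \<open>Every test function differs from a multiple of a fixed one by some \<open>\<psi>'\<close>, namely when the multiple matches the means.
So \<open>f - c\<close> annihilates all test functions for the appropriate \<open>c\<close>.\<close>

lemma du_Bois_Reymond:
  assumes f: "integrable unit_measure f"
    and zero: "\<And>\<psi> \<psi>'. test_function \<psi> \<psi>' \<Longrightarrow> (LINT x|unit_measure. f x * \<psi>' x) = 0"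
  shows "\<exists>c. AE x in unit_measure. f x = c"
proof -
  \<comment> \<open>If all test functions had mean zero, the constant 1 would vanish almost everywhere.\<close>
  have "\<exists>\<eta> \<eta>'. test_function \<eta> \<eta>' \<and> (LINT x|unit_measure. \<eta> x) \<noteq> 0"
  proof (rule ccontr)
    assume no: "\<not> ?thesis"
    have "AE x in unit_measure. (1::real) = 0"
      by (rule AE_zero_of_test_functions[OF integrable_unit_const]) (use no in auto)
    then have "emeasure unit_measure {x \<in> space unit_measure. True} = 0"
      by (intro emeasure_eq_0_AE) simp
    also have "{x \<in> space unit_measure. True} = {0<..<1}" by (auto simp: space_unit)
    finally show False by (simp add: emeasure_restrict_space)
  qed
  then obtain \<eta>0 \<eta>0' where \<eta>0: "test_function \<eta>0 \<eta>0'" and I0: "(LINT x|unit_measure. \<eta>0 x) \<noteq> 0" by blast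
  define I0 where "I0 = (LINT x|unit_measure. \<eta>0 x)"
  define c where "c = (LINT x|unit_measure. f x * \<eta>0 x) / I0"
  have "AE x in unit_measure. f x - c = 0"
  proof (rule AE_zero_of_test_functions)
    show "integrable unit_measure (\<lambda>x. f x - c)" using f integrable_unit_const by auto
    fix \<eta> \<eta>' assume \<eta>: "test_function \<eta> \<eta>'"
    define J where "J = (LINT x|unit_measure. \<eta> x)"
    define \<zeta> where "\<zeta> x = \<eta> x - J / I0 * \<eta>0 x" for x
    have ct: "continuous_on A \<eta>" "continuous_on A \<eta>0" for A
      using test_function_continuous \<eta> \<eta>0 by blast+
    note int = integrable_continuous_unit[OF ct(1)] integrable_continuous_unit[OF ct(2)]
      integrable_mult_continuous_unit[OF f ct(1)] integrable_mult_continuous_unit[OF f ct(2)]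
    obtain K K0 where K: "compact K" "K \<subseteq> {0<..<1}" "\<And>x. x \<notin> K \<Longrightarrow> \<eta> x = 0"
      "compact K0" "K0 \<subseteq> {0<..<1}" "\<And>x. x \<notin> K0 \<Longrightarrow> \<eta>0 x = 0"
      using \<eta> \<eta>0 unfolding test_function_def by metis
    have "\<exists>\<psi>. test_function \<psi> \<zeta>"
    proof (rule mean_zero_test_function_primitive[of _ "K \<union> K0"])
      show "continuous_on UNIV \<zeta>" unfolding \<zeta>_def[abs_def] by (intro continuous_intros ct)
      have "(LINT x|unit_measure. \<zeta> x) = J - J / I0 * I0"
        unfolding \<zeta>_def J_def I0_def using int by simp
      then show "(LINT x|unit_measure. \<zeta> x) = 0" using I0 unfolding I0_def by simp
      show "\<zeta> x = 0" if "x \<notin> K \<union> K0" for x unfolding \<zeta>_def using K(3,6) that by simp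
    qed (use K in auto)
    then have "0 = (LINT x|unit_measure. f x * \<zeta> x)" using zero by metis
    also have "\<dots> = (LINT x|unit_measure. f x * \<eta> x - J / I0 * (f x * \<eta>0 x))"
      unfolding \<zeta>_def by (intro Bochner_Integration.integral_cong) (auto simp: algebra_simps)
    also have "\<dots> = (LINT x|unit_measure. f x * \<eta> x) - J / I0 * (LINT x|unit_measure. f x * \<eta>0 x)"
      using int by simp
    also have "\<dots> = (LINT x|unit_measure. f x * \<eta> x) - c * (LINT x|unit_measure. \<eta> x)"
      unfolding c_def J_def by simp
    also have "\<dots> = (LINT x|unit_measure. f x * \<eta> x - c * \<eta> x)" using int by simp
    also have "\<dots> = (LINT x|unit_measure. (f x - c) * \<eta> x)"
      by (intro Bochner_Integration.integral_cong) (auto simp: algebra_simps)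
    finally show "(LINT x|unit_measure. (f x - c) * \<eta> x) = 0" by simp
  qed
  then show ?thesis by (intro exI[of _ c]) auto
qed

lemma weak_deriv_cong_AE:
  assumes "weak_deriv_of f g" "integrable unit_measure f" "integrable unit_measure g"
    "integrable unit_measure f1" "integrable unit_measure g1"
    "AE x in unit_measure. f x = f1 x" "AE x in unit_measure. g x = g1 x"
  shows "weak_deriv_of f1 g1"
  unfolding weak_deriv_of_iff
proof (intro allI impI)
  fix \<psi> \<psi>' assume t: "test_function \<psi> \<psi>'"
  note ct = test_function_continuous[OF t]
  have m: "(\<lambda>x. u x * v x) \<in> borel_measurable unit_measure" if "integrable unit_measure u" "continuous_on {0..1} v" for u v :: "real \<Rightarrow> real"
    using integrable_mult_continuous_unit[OF that] by auto
  have "(LINT x|unit_measure. f1 x * \<psi>' x) = (LINT x|unit_measure. f x * \<psi>' x)"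
  proof (rule integral_cong_AE)
    show "AE x in unit_measure. f1 x * \<psi>' x = f x * \<psi>' x" using assms(6) by eventually_elim simp
  qed (use m assms ct in blast)+
  also have "\<dots> = - (LINT x|unit_measure. g x * \<psi> x)" using assms(1) t unfolding weak_deriv_of_iff by blast
  also have "(LINT x|unit_measure. g x * \<psi> x) = (LINT x|unit_measure. g1 x * \<psi> x)"
  proof (rule integral_cong_AE)
    show "AE x in unit_measure. g x * \<psi> x = g1 x * \<psi> x" using assms(7) by eventually_elim simp
  qed (use m assms ct in blast)+
  finally show "(LINT x|unit_measure. f1 x * \<psi>' x) = - (LINT x|unit_measure. g1 x * \<psi> x)" .
qed

lemma weak_deriv_unique:
  assumes "weak_deriv_of f g1" "weak_deriv_of f g2" "integrable unit_measure g1" "integrable unit_measure g2"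
  shows "AE x in unit_measure. g1 x = g2 x"
proof -
  have "AE x in unit_measure. g1 x - g2 x = 0"
  proof (rule AE_zero_of_test_functions)
    show "integrable unit_measure (\<lambda>x. g1 x - g2 x)" using assms by auto
    fix \<psi> \<psi>' assume t: "test_function \<psi> \<psi>'"
    have "(LINT x|unit_measure. (g1 x - g2 x) * \<psi> x) = (LINT x|unit_measure. g1 x * \<psi> x) - (LINT x|unit_measure. g2 x * \<psi> x)"
      unfolding left_diff_distrib
      using assms(3,4) test_function_continuous[OF t]
      by (intro Bochner_Integration.integral_diff integrable_mult_continuous_unit)
    also have "\<dots> = 0"
      using assms(1)[unfolded weak_deriv_of_iff, rule_format, OF t]
        assms(2)[unfolded weak_deriv_of_iff, rule_format, OF t] by linarith
    finally show "(LINT x|unit_measure. (g1 x - g2 x) * \<psi> x) = 0" .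
  qed
  then show ?thesis by auto
qed

text \<open>The classical primitive \<open>G\<close> has the same weak derivative as \<open>f\<close>, so \<open>f - G\<close> is constant.  This is the step
that turns weak derivatives into classical ones.\<close>

lemma weak_deriv_continuous_primitive:
  assumes f: "integrable unit_measure f" and w: "weak_deriv_of f g" and cont: "continuous_on {0..1} g"
    and G: "\<And>x. x \<in> {0..1} \<Longrightarrow> (G has_real_derivative g x) (at x within {0..1})"
  shows "\<exists>c. AE x in unit_measure. f x = G x + c"
proof -
  have Gc: "continuous_on {0..1} G" by (rule DERIV_continuous_on[OF G])
  have "\<exists>c. AE x in unit_measure. f x - G x = c"
  proof (rule du_Bois_Reymond)
    show "integrable unit_measure (\<lambda>x. f x - G x)" using f integrable_continuous_unit[OF Gc] by auto
    fix \<psi> \<psi>' assume t: "test_function \<psi> \<psi>'"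
    note ct = test_function_continuous[OF t]
    have d: "(\<psi> has_real_derivative \<psi>' x) (at x within {0..1})" for x
      using t unfolding test_function_def by (meson has_field_derivative_at_within)
    have "(LINT x|unit_measure. g x * \<psi> x + G x * \<psi>' x) = G 1 * \<psi> 1 - G 0 * \<psi> 0"
    proof (rule unit_integral_derivative)
      show "((\<lambda>x. G x * \<psi> x) has_real_derivative g x * \<psi> x + G x * \<psi>' x) (at x within {0..1})" if "x \<in> {0..1}" for x
        by (rule derivative_eq_intros G[OF that] d refl)+ simp
    qed (intro continuous_intros cont Gc ct)
    then have "(LINT x|unit_measure. g x * \<psi> x + G x * \<psi>' x) = 0"
      using test_function_endpoints[OF t] by simp
    moreover have "(LINT x|unit_measure. g x * \<psi> x + G x * \<psi>' x) = (LINT x|unit_measure. g x * \<psi> x) + (LINT x|unit_measure. G x * \<psi>' x)"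
      by (intro Bochner_Integration.integral_add integrable_continuous_unit continuous_intros cont Gc ct)
    moreover have "(LINT x|unit_measure. f x * \<psi>' x) = - (LINT x|unit_measure. g x * \<psi> x)"
      using w t unfolding weak_deriv_of_iff by blast
    moreover have "(LINT x|unit_measure. (f x - G x) * \<psi>' x) = (LINT x|unit_measure. f x * \<psi>' x) - (LINT x|unit_measure. G x * \<psi>' x)"
      unfolding left_diff_distrib
      by (intro Bochner_Integration.integral_diff integrable_mult_continuous_unit f ct integrable_continuous_unit[OF Gc])
    ultimately show "(LINT x|unit_measure. (f x - G x) * \<psi>' x) = 0" by linarith
  qed
  then obtain c where "AE x in unit_measure. f x - G x = c" by blast
  then have "AE x in unit_measure. f x = G x + c" by eventually_elim simp
  then show ?thesis by blast
qed

text \<open>The set where \<open>f\<close> does not vanish is open in the interior and negligible, hence empty.\<close>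

lemma continuous_AE_zero:
  assumes cont: "continuous_on {0..1} (f :: real \<Rightarrow> real)" and "AE x in unit_measure. f x = 0" and x: "x \<in> {0..1}"
  shows "f x = 0"
proof -
  define S where "S = {x \<in> {0<..<1}. f x \<noteq> 0}"
  have "S = {0<..<1} \<inter> f -` (- {0})" unfolding S_def by auto
  also have "open \<dots>"
    by (intro continuous_open_preimage continuous_on_subset[OF cont]) auto
  finally have "open S" .
  have "AE x in lebesgue. x \<in> {0<..<1} \<longrightarrow> f x = 0"
    using assms(2) by (subst (asm) AE_restrict_space_iff) auto
  then have "AE x in lebesgue. x \<notin> S" unfolding S_def by eventually_elim auto
  then have "negligible S"
    using \<open>open S\<close> by (simp add: negligible_iff_null_sets AE_iff_null_sets borel_open)
  then have "S = {}" using open_not_negligible \<open>open S\<close> by blast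
  then have z: "f t = 0" if "t \<in> {0<..<1}" for t using that unfolding S_def by blast
  show ?thesis
  proof (rule continuous_constant_on_closure[where S = "{0<..<1}" and f = f and x = x and a = 0])
    show "continuous_on (closure {0<..<1}) f" using cont by simp
    show "x \<in> closure {0<..<1}" using x by simp
  qed (rule z)
qed

lemma smooth_near_unit_derivative:
  assumes "smooth_near_unit f"
  obtains F U where "open U" "{0..1} \<subseteq> U" "\<And>x. x \<in> U \<Longrightarrow> (F has_real_derivative deriv F x) (at x)"
    "continuous_on U (deriv F)" "\<And>x. x \<in> {0..1} \<Longrightarrow> F x = f x"
proof -
  obtain F U where U: "open U" "{0..1} \<subseteq> U" "\<And>k. ((deriv ^^ k) F) differentiable_on U"
    "\<And>x. x \<in> {0..1} \<Longrightarrow> F x = f x"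
    using assms unfolding smooth_near_unit_def by blast
  have "(F has_real_derivative deriv F x) (at x)" if "x \<in> U" for x
  proof -
    have "F differentiable (at x)"
      using U(3)[of 0] U(1) that by (simp add: differentiable_on_eq_differentiable_at)
    then show ?thesis by (simp add: DERIV_deriv_iff_real_differentiable)
  qed
  moreover have "continuous_on U (deriv F)"
    using U(3)[of 1] by (simp add: differentiable_imp_continuous_on)
  ultimately show ?thesis using that U by blast
qed

text \<open>The product rule, by testing \<open>g\<close> with \<open>F \<psi>\<close>.  It provides a weak derivative of \<open>p h'\<close>
for \<open>h\<close> in \<open>H2_unit\<close>, without which the choice made by \<open>weak_deriv\<close> inside \<open>SL_op\<close> would be arbitrary.\<close>

lemma weak_deriv_smooth_mult:
  assumes U: "open U" "{0..1} \<subseteq> U" and F: "\<And>x. x \<in> U \<Longrightarrow> (F has_real_derivative F' x) (at x)"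
    and F': "continuous_on U F'" and w: "weak_deriv_of g k"
    and g: "integrable unit_measure g" and k: "integrable unit_measure k"
  shows "weak_deriv_of (\<lambda>x. F x * g x) (\<lambda>x. F' x * g x + F x * k x)"
  unfolding weak_deriv_of_iff
proof (intro allI impI)
  fix \<psi> \<psi>' assume t: "test_function \<psi> \<psi>'"
  note ct = test_function_continuous[OF t]
  have d: "(\<psi> has_real_derivative \<psi>' x) (at x)" for x using t unfolding test_function_def by blast
  obtain K where K: "compact K" "K \<subseteq> {0<..<1}" "\<And>x. x \<notin> K \<Longrightarrow> \<psi> x = 0"
    using t unfolding test_function_def by metis
  have KU: "K \<subseteq> U" using K(2) U(2) by (meson greaterThanLessThan_subseteq_atLeastAtMost_iff order.refl order.trans)
  have clK: "closed K" using K(1) compact_imp_closed by blast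
  have z: "\<psi>' x = 0" if "x \<notin> K" for x
    using test_function_deriv_outside[OF d clK K(3) that] .
  define X where "X x = F x * \<psi> x" for x
  define X' where "X' x = F' x * \<psi> x + F x * \<psi>' x" for x
  have Fc: "continuous_on U F" using F by (meson DERIV_isCont continuous_at_imp_continuous_on)
  have "test_function X X'"
    unfolding test_function_def
  proof (intro conjI allI impI exI[of _ K])
    fix x
    show "(X has_real_derivative X' x) (at x)"
    proof (cases "x \<in> K")
      case True
      then have "x \<in> U" using KU by blast
      show ?thesis unfolding X_def[abs_def] X'_def
        by (rule derivative_eq_intros F[OF \<open>x \<in> U\<close>] d refl)+ simp
    next
      case False
      have "((\<lambda>x. 0) has_real_derivative 0) (at x)" by simp
      then have "(X has_real_derivative 0) (at x)"
        by (rule has_field_derivative_transform_within_open[where S = "- K"])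
           (use False clK K(3) in \<open>auto simp: X_def\<close>)
      then show ?thesis using K(3)[OF False] z[OF False] unfolding X'_def by simp
    qed
    show "X x = 0" if "x \<notin> K" using K(3)[OF that] unfolding X_def by simp
  next
    have "continuous_on (U \<union> - K) X'"
    proof (rule continuous_on_open_Un)
      show "continuous_on U X'" unfolding X'_def[abs_def] by (intro continuous_intros F' Fc ct)
      have "continuous_on (- K) (\<lambda>x. 0 :: real)" by simp
      then show "continuous_on (- K) X'"
        by (rule continuous_on_eq) (use z K(3) in \<open>auto simp: X'_def\<close>)
    qed (use U clK in auto)
    then show "continuous_on UNIV X'" using KU by (metis Compl_partition Un_mono order.refl top.extremum_unique)
  qed (use K in auto)
  then have "(LINT x|unit_measure. g x * X' x) = - (LINT x|unit_measure. k x * X x)"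
    using w unfolding weak_deriv_of_iff by blast
  moreover have c01: "continuous_on {0..1} F" "continuous_on {0..1} F'"
    using continuous_on_subset Fc F' U(2) by blast+
  moreover have "(LINT x|unit_measure. g x * X' x) = (LINT x|unit_measure. g x * (F' x * \<psi> x)) + (LINT x|unit_measure. g x * (F x * \<psi>' x))"
    unfolding X'_def distrib_left
    by (intro Bochner_Integration.integral_add integrable_mult_continuous_unit g continuous_intros c01 ct)
  moreover have "(LINT x|unit_measure. (F' x * g x + F x * k x) * \<psi> x)
     = (LINT x|unit_measure. g x * (F' x * \<psi> x)) + (LINT x|unit_measure. k x * X x)"
  proof -
    have "(LINT x|unit_measure. (F' x * g x + F x * k x) * \<psi> x) = (LINT x|unit_measure. g x * (F' x * \<psi> x) + k x * X x)"
      unfolding X_def by (intro Bochner_Integration.integral_cong) (auto simp: algebra_simps)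
    also have "\<dots> = (LINT x|unit_measure. g x * (F' x * \<psi> x)) + (LINT x|unit_measure. k x * X x)"
      unfolding X_def
      by (intro Bochner_Integration.integral_add integrable_mult_continuous_unit g k continuous_intros c01 ct)
    finally show ?thesis .
  qed
  moreover have "(LINT x|unit_measure. F x * g x * \<psi>' x) = (LINT x|unit_measure. g x * (F x * \<psi>' x))"
    by (intro Bochner_Integration.integral_cong) (auto simp: mult_ac)
  ultimately show "(LINT x|unit_measure. F x * g x * \<psi>' x) = - (LINT x|unit_measure. (F' x * g x + F x * k x) * \<psi> x)"
    by linarith
qed

lemma weak_derivI:
  assumes "g \<in> L2_unit" "weak_deriv_of f g"
  shows "weak_deriv f \<in> L2_unit" "weak_deriv_of f (weak_deriv f)"
  using someI[of "\<lambda>g. g \<in> L2_unit \<and> weak_deriv_of f g" g] assms unfolding weak_deriv_def by auto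

lemma continuous_primitive_unit:
  assumes "continuous_on {0..1} (g :: real \<Rightarrow> real)" "x \<in> {0..1}"
  shows "((\<lambda>x. integral {0..x} g) has_real_derivative g x) (at x within {0..1})"
  using integral_has_vector_derivative[OF assms]
  by (simp add: has_real_derivative_iff_has_vector_derivative)

section \<open>Regularity of eigenfunctions\<close>

text \<open>The function \<open>v\<close> is the quasi-derivative \<open>p h'\<close>.\<close>

definition classical_eigenvalue :: "(real \<Rightarrow> real) \<Rightarrow> (real \<Rightarrow> real) \<Rightarrow> real \<Rightarrow> bool" where
  "classical_eigenvalue p q \<mu> \<longleftrightarrow> (\<exists>h v. (\<forall>x\<in>{0..1}. (h has_real_derivative v x / p x) (at x within {0..1}) \<and>
     (v has_real_derivative - (q x + \<mu>) * h x) (at x within {0..1})) \<and> h 0 = 0 \<and> h 1 = 0 \<and>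
     (\<exists>x\<in>{0..1}. h x \<noteq> 0))"

text \<open>The eigenvalue equation says that \<open>p h'\<close> has the continuous weak derivative \<open>- (q + \<mu>) h\<close>, hence is almost
everywhere a C1 function \<open>v\<close>; then \<open>h\<close> has the continuous weak derivative \<open>v / p\<close> and, being continuous, equals a
primitive of it everywhere.\<close>

lemma SL_eigenvalue_classical:
  assumes eig: "SL_eigenvalue p q \<mu>" and smooth: "smooth_near_unit p" "smooth_near_unit q"
    and pos: "\<And>x. x \<in> {0..1} \<Longrightarrow> p x > 0"
  shows "classical_eigenvalue p q \<mu>"
proof -
  obtain h where h: "h \<in> H2_unit" "continuous_on {0..1} h" "h 0 = 0" "h 1 = 0"
    and nz: "\<not> (AE x in unit_measure. h x = 0)" and eq: "AE x in unit_measure. SL_op p q h x = \<mu> * h x"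
    using eig unfolding SL_eigenvalue_def SL_domain_def by blast
  obtain P U where U: "open U" "{0..1} \<subseteq> U" and P: "\<And>x. x \<in> U \<Longrightarrow> (P has_real_derivative deriv P x) (at x)"
    and P': "continuous_on U (deriv P)" and Pp: "\<And>x. x \<in> {0..1} \<Longrightarrow> P x = p x"
    using smooth_near_unit_derivative[OF smooth(1)] by metis
  have "continuous_on U P" using P by (meson DERIV_isCont continuous_at_imp_continuous_on)
  then have Pc: "continuous_on {0..1} P" "continuous_on {0..1} (deriv P)"
    using P' U(2) continuous_on_subset by blast+
  then have pc: "continuous_on {0..1} p" using Pp by (metis (no_types, lifting) continuous_on_cong)
  obtain Qf V where V: "{0..1} \<subseteq> V" "\<And>x. x \<in> V \<Longrightarrow> (Qf has_real_derivative deriv Qf x) (at x)"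
    and Qq: "\<And>x. x \<in> {0..1} \<Longrightarrow> Qf x = q x"
    using smooth_near_unit_derivative[OF smooth(2)] by metis
  have "continuous_on {0..1} Qf" using V by (meson DERIV_isCont continuous_at_imp_continuous_on subsetD)
  then have qc: "continuous_on {0..1} q" using Qq by (metis (no_types, lifting) continuous_on_cong)
  have hL: "h \<in> L2_unit" and "\<exists>g0\<in>H1_unit. weak_deriv_of h g0" using h(1) unfolding H2_unit_def by auto
  then obtain g0 k where g0: "g0 \<in> L2_unit" "weak_deriv_of h g0" and k: "k \<in> L2_unit" "weak_deriv_of g0 k"
    unfolding H1_unit_def by auto
  define g where "g = weak_deriv h"
  have g: "g \<in> L2_unit" "weak_deriv_of h g" unfolding g_def using weak_derivI[OF g0] by auto
  note int = L2_unit_integrable[OF hL] L2_unit_integrable[OF g0(1)] L2_unit_integrable[OF k(1)] L2_unit_integrable[OF g(1)]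
  have "AE x in unit_measure. g0 x = g x" by (rule weak_deriv_unique[OF g0(2) g(2) int(2,4)])
  then have gk: "weak_deriv_of g k"
    using weak_deriv_cong_AE[OF k(2) int(2,3) int(4,3)] by simp
  have unitAE: "AE x in unit_measure. x \<in> {0..1}"
    by (rule AE_I2) (simp add: space_unit)
  have pgL: "(\<lambda>x. p x * g x) \<in> L2_unit" by (rule L2_unit_mult_continuous[OF g(1) pc])
  have rL: "(\<lambda>x. deriv P x * g x + P x * k x) \<in> L2_unit"
    by (intro L2_unit_add L2_unit_mult_continuous g k Pc)
  have "weak_deriv_of (\<lambda>x. p x * g x) (\<lambda>x. deriv P x * g x + P x * k x)"
  proof (rule weak_deriv_cong_AE)
    show "weak_deriv_of (\<lambda>x. P x * g x) (\<lambda>x. deriv P x * g x + P x * k x)"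
      by (rule weak_deriv_smooth_mult[OF U P P' gk int(4,3)])
    show "AE x in unit_measure. P x * g x = p x * g x"
      using unitAE by eventually_elim (simp add: Pp)
  qed (use L2_unit_integrable[OF L2_unit_mult_continuous[OF g(1) Pc(1)]] L2_unit_integrable[OF rL] L2_unit_integrable[OF pgL] in auto)
  \<comment> \<open>As \<open>p h'\<close> has some weak derivative, the one selected in \<open>SL_op\<close> is a genuine weak derivative.\<close>
  note r = weak_derivI[OF rL this]
  define s where "s x = - (q x + \<mu>) * h x" for x
  have sc: "continuous_on {0..1} s" unfolding s_def[abs_def] by (intro continuous_intros qc h)
  have "AE x in unit_measure. weak_deriv (\<lambda>t. p t * g t) x = s x"
    using eq unfolding SL_op_def g_def[symmetric] s_def by eventually_elim (simp add: algebra_simps)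
  then have ws: "weak_deriv_of (\<lambda>x. p x * g x) s"
    using weak_deriv_cong_AE[OF r(2) L2_unit_integrable[OF pgL] L2_unit_integrable[OF r(1)] L2_unit_integrable[OF pgL] integrable_continuous_unit[OF sc]]
    by simp
  obtain c where c: "AE x in unit_measure. p x * g x = integral {0..x} s + c"
    using weak_deriv_continuous_primitive[OF L2_unit_integrable[OF pgL] ws sc continuous_primitive_unit[OF sc]] by blast
  define v where "v x = integral {0..x} s + c" for x
  have vd: "(v has_real_derivative s x) (at x within {0..1})" if "x \<in> {0..1}" for x
    unfolding v_def[abs_def] by (rule derivative_eq_intros continuous_primitive_unit[OF sc that] refl)+ simp
  have vc: "continuous_on {0..1} v" by (rule DERIV_continuous_on[OF vd])
  have vpc: "continuous_on {0..1} (\<lambda>x. v x / p x)"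
    using pos by (intro continuous_intros vc pc) (auto simp: less_imp_neq[symmetric])
  have "AE x in unit_measure. g x = v x / p x"
    using c unitAE
  proof eventually_elim
    fix x assume "p x * g x = integral {0..x} s + c" "x \<in> {0..1}"
    then show "g x = v x / p x" using pos[of x] unfolding v_def by (simp add: field_simps)
  qed
  then have wh: "weak_deriv_of h (\<lambda>x. v x / p x)"
    using weak_deriv_cong_AE[OF g(2) int(1,4) int(1) integrable_continuous_unit[OF vpc]] by simp
  define H where "H x = integral {0..x} (\<lambda>x. v x / p x)" for x
  have Hd: "(H has_real_derivative v x / p x) (at x within {0..1})" if "x \<in> {0..1}" for x
    unfolding H_def[abs_def] by (rule continuous_primitive_unit[OF vpc that])
  obtain c' where c': "AE x in unit_measure. h x = H x + c'"
    using weak_deriv_continuous_primitive[OF int(1) wh vpc Hd] by blast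
  have hH: "h x - (H x + c') = 0" if "x \<in> {0..1}" for x
  proof (rule continuous_AE_zero[where f = "\<lambda>x. h x - (H x + c')", OF _ _ that])
    show "continuous_on {0..1} (\<lambda>x. h x - (H x + c'))"
      by (intro continuous_intros h DERIV_continuous_on[OF Hd])
    show "AE x in unit_measure. h x - (H x + c') = 0" using c' by eventually_elim simp
  qed
  have hd: "(h has_real_derivative v x / p x) (at x within {0..1})" if x: "x \<in> {0..1}" for x
  proof (rule has_field_derivative_transform_within[where f = "\<lambda>x. H x + c'" and d = 1])
    show "((\<lambda>x. H x + c') has_real_derivative v x / p x) (at x within {0..1})"
      by (rule derivative_eq_intros Hd[OF x] refl)+ simp
  qed (use x hH in auto)
  moreover have "\<exists>x\<in>{0..1}. h x \<noteq> 0"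
  proof (rule ccontr)
    assume no: "\<not> ?thesis"
    have "AE x in unit_measure. h x = 0" using unitAE by eventually_elim (use no in auto)
    then show False using nz by blast
  qed
  ultimately show ?thesis using vd h(3,4) unfolding s_def classical_eigenvalue_def by blast
qed

section \<open>Spacing of the Sturm-Liouville spectrum\<close>

text \<open>Gronwall's inequality with a source.  The rate \<open>k\<close> may be negative, which yields lower bounds when applied to
\<open>- E\<close>.\<close>

lemma gronwall_unit:
  fixes E E' :: "real \<Rightarrow> real"
  assumes der: "\<And>x. x \<in> {0..1} \<Longrightarrow> (E has_real_derivative E' x) (at x within {0..1})"
    and le: "\<And>x. x \<in> {0..1} \<Longrightarrow> E' x \<le> k * E x + s * exp (k * x)" and x: "x \<in> {0..1}"
  shows "E x \<le> (E 0 + s * x) * exp (k * x)"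
proof -
  define f where "f x = E x * exp (- (k * x)) - s * x" for x
  have fd: "(f has_real_derivative (E' x - k * E x) * exp (- (k * x)) - s) (at x within {0..1})"
    if "x \<in> {0..1}" for x
    unfolding f_def
    by (rule derivative_eq_intros der[OF that] refl)+ (simp add: algebra_simps)
  have "f x \<le> f 0"
  proof (rule DERIV_nonpos_imp_decreasing_open[of 0 x f])
    show "0 \<le> x" using x by simp
    fix t assume t: "0 < t" "t < x"
    then have "t \<in> {0..1}" using x by auto
    have "(E' t - k * E t) * exp (- (k * t)) \<le> (s * exp (k * t)) * exp (- (k * t))"
      using le[OF \<open>t \<in> {0..1}\<close>] by (intro mult_right_mono) auto
    also have "\<dots> = s" by (simp add: mult.assoc flip: exp_add)
    finally have "(E' t - k * E t) * exp (- (k * t)) - s \<le> 0" by simp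
    moreover have "at t within {0..1} = at t" using t x by (intro at_within_interior) auto
    ultimately show "\<exists>y. DERIV f t :> y \<and> y \<le> 0" using fd[OF \<open>t \<in> {0..1}\<close>] by metis
  next
    show "continuous_on {0..x} f"
    proof (rule continuous_on_subset)
      show "continuous_on {0..1} f" by (rule DERIV_continuous_on[OF fd])
    qed (use x in auto)
  qed
  then have "E x * exp (- (k * x)) * exp (k * x) \<le> (E 0 + s * x) * exp (k * x)"
    unfolding f_def by (intro mult_right_mono) auto
  then show ?thesis by (simp add: mult.assoc flip: exp_add)
qed

locale SL_coefficients =
  fixes p p' q :: "real \<Rightarrow> real" and p0 p1 P Q :: real
  assumes p0: "p0 > 0"
    and p_bounds: "\<And>x. x \<in> {0..1} \<Longrightarrow> p0 \<le> p x \<and> p x \<le> p1"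
    and p_deriv: "\<And>x. x \<in> {0..1} \<Longrightarrow> (p has_real_derivative p' x) (at x within {0..1})"
    and p'_bound: "\<And>x. x \<in> {0..1} \<Longrightarrow> \<bar>p' x\<bar> \<le> P"
    and q_bound: "\<And>x. x \<in> {0..1} \<Longrightarrow> \<bar>q x\<bar> \<le> Q"
begin

lemma p_pos: "x \<in> {0..1} \<Longrightarrow> p x > 0"
  using p0 p_bounds[of x] by linarith

lemma consts_nonneg: "P \<ge> 0" "Q \<ge> 0" "p1 > 0"
  using p'_bound[of 0] q_bound[of 0] p_bounds[of 0] p0 by auto

text \<open>The eigenvalue equation for \<open>\<mu> = \<omega>\<^sup>2\<close> as a first order system in \<open>u = \<omega> h\<close>, \<open>w = p h'\<close>.  In this scaling
both components have the same size for large \<open>\<omega>\<close>.\<close>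

definition flow :: "real \<Rightarrow> (real \<Rightarrow> real) \<Rightarrow> (real \<Rightarrow> real) \<Rightarrow> bool" where
  "flow \<omega> u w \<longleftrightarrow> (\<forall>x\<in>{0..1}. (u has_real_derivative \<omega> * w x / p x) (at x within {0..1}) \<and>
     (w has_real_derivative - (\<omega> + q x / \<omega>) * u x) (at x within {0..1}))"

text \<open>The weight \<open>p\<close> is chosen such that the terms of order \<open>\<omega>\<close> cancel in the derivative along the flow.\<close>

definition energy :: "(real \<Rightarrow> real) \<Rightarrow> (real \<Rightarrow> real) \<Rightarrow> real \<Rightarrow> real" where
  "energy u w x = p x * (u x)\<^sup>2 + (w x)\<^sup>2"

definition energy_rate where "energy_rate = (P + Q) / p0 + Q"

lemma energy_rate_nonneg: "energy_rate \<ge> 0"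
  unfolding energy_rate_def using consts_nonneg p0 by simp

lemma energy_parts:
  assumes "x \<in> {0..1}"
  shows "(u x)\<^sup>2 \<le> energy u w x / p0" "(w x)\<^sup>2 \<le> energy u w x" "energy u w x \<ge> 0"
proof -
  have "p0 * (u x)\<^sup>2 \<le> p x * (u x)\<^sup>2" using p_bounds[OF assms] by (intro mult_right_mono) auto
  then have a: "p0 * (u x)\<^sup>2 \<le> energy u w x" unfolding energy_def by (simp add: add_increasing2)
  then show "(u x)\<^sup>2 \<le> energy u w x / p0" using p0 by (simp add: field_simps)
  show "(w x)\<^sup>2 \<le> energy u w x" unfolding energy_def using p_pos[OF assms] by simp
  have "0 \<le> p0 * (u x)\<^sup>2" using p0 by simp
  then show "energy u w x \<ge> 0" using a by linarith
qed

lemma two_mult_le_squares: "\<bar>2 * (a * b)\<bar> \<le> a\<^sup>2 + b\<^sup>2" for a b :: real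
  using sum_squares_bound[of a b] sum_squares_bound[of a "- b"] by (auto simp: abs_if)

text \<open>The expression estimated here is the derivative of the energy along the flow; the bound does not involve \<open>\<omega>\<close>.\<close>

lemma damping_bound:
  assumes "x \<in> {0..1}" "\<omega> \<ge> 1"
  shows "\<bar>p' x * (u x)\<^sup>2 - 2 * (q x / \<omega>) * (u x * w x)\<bar> \<le> energy_rate * energy u w x"
proof -
  note e = energy_parts[OF assms(1), where u = u and w = w]
  have "\<bar>p' x * (u x)\<^sup>2\<bar> \<le> P * (energy u w x / p0)"
    unfolding abs_mult using p'_bound[OF assms(1)] e consts_nonneg by (intro mult_mono) auto
  moreover have "\<bar>2 * (q x / \<omega>) * (u x * w x)\<bar> \<le> Q * (energy u w x / p0 + energy u w x)"
  proof -
    have "\<bar>q x / \<omega>\<bar> \<le> Q / 1"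
      unfolding abs_divide using q_bound[OF assms(1)] assms(2) by (intro frac_le) auto
    then have "\<bar>q x / \<omega>\<bar> * \<bar>2 * (u x * w x)\<bar> \<le> Q * ((u x)\<^sup>2 + (w x)\<^sup>2)"
      using two_mult_le_squares[of "u x" "w x"] consts_nonneg by (intro mult_mono) auto
    also have "\<dots> \<le> Q * (energy u w x / p0 + energy u w x)"
      using e consts_nonneg by (intro mult_left_mono add_mono) auto
    finally show ?thesis by (simp add: abs_mult mult_ac)
  qed
  moreover have "P * (energy u w x / p0) + Q * (energy u w x / p0 + energy u w x) = energy_rate * energy u w x"
    unfolding energy_rate_def by (simp add: add_divide_distrib algebra_simps)
  ultimately show ?thesis by linarith
qed

lemma energy_bounds:
  assumes "\<omega> \<ge> 1" "flow \<omega> u w" and x: "x \<in> {0..1}"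
  shows "energy u w x \<le> energy u w 0 * exp energy_rate" and "energy u w 0 * exp (- energy_rate) \<le> energy u w x"
proof -
  define E' where "E' x = p' x * (u x)\<^sup>2 - 2 * (q x / \<omega>) * (u x * w x)" for x
  have der: "(energy u w has_real_derivative E' x) (at x within {0..1})" if "x \<in> {0..1}" for x
  proof -
    note f = assms(2)[unfolded flow_def, rule_format, OF that]
    have "p x \<noteq> 0" using p_pos[OF that] by simp
    then show ?thesis
      unfolding energy_def[abs_def] E'_def
      by (auto intro!: derivative_eq_intros p_deriv[OF that] f[THEN conjunct1] f[THEN conjunct2])
         (simp add: field_simps power2_eq_square)
  qed
  have b: "\<bar>E' x\<bar> \<le> energy_rate * energy u w x" if "x \<in> {0..1}" for x
    unfolding E'_def using damping_bound[OF that assms(1)] .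
  have e0: "energy u w 0 \<ge> 0" by (rule energy_parts) simp
  have "energy u w x \<le> (energy u w 0 + 0 * x) * exp (energy_rate * x)"
    by (rule gronwall_unit[where E = "energy u w" and E' = E', OF der]) (use b x in \<open>auto simp: abs_le_iff\<close>)
  also have "\<dots> \<le> energy u w 0 * exp energy_rate"
    using e0 x energy_rate_nonneg by (simp add: mult_left_mono mult_left_le)
  finally show "energy u w x \<le> energy u w 0 * exp energy_rate" .
  have "- energy u w x \<le> (- energy u w 0 + 0 * x) * exp ((- energy_rate) * x)"
  proof (rule gronwall_unit[where E = "\<lambda>x. - energy u w x" and E' = "\<lambda>x. - E' x"])
    show "((\<lambda>x. - energy u w x) has_real_derivative - E' t) (at t within {0..1})" if "t \<in> {0..1}" for t
      using der[OF that] by (rule DERIV_minus)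
  qed (use b x in \<open>auto simp: abs_le_iff\<close>)
  moreover have "energy u w 0 * exp (- energy_rate) \<le> energy u w 0 * exp ((- energy_rate) * x)"
    using e0 x energy_rate_nonneg by (intro mult_left_mono) (auto simp: mult_left_le)
  ultimately show "energy u w 0 * exp (- energy_rate) \<le> energy u w x" by simp
qed

definition difference_rate where "difference_rate = energy_rate + 1 / p0 + 1"
definition source_const where "source_const = exp energy_rate + (1 + Q)\<^sup>2 * (exp energy_rate / p0)"

lemma source_const_pos: "source_const > 0"
  unfolding source_const_def using p0 consts_nonneg by (intro add_pos_nonneg) auto

text \<open>The difference of two solutions satisfies the system for \<open>\<omega>1\<close> with a source proportional to
\<open>\<omega>1 - \<omega>2\<close>; because the energy estimate is uniform in the frequency, so is the Lipschitz constant.\<close>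

lemma flow_difference:
  assumes "\<omega>1 \<ge> 1" "\<omega>2 \<ge> 1" and f1: "flow \<omega>1 u1 w1" and f2: "flow \<omega>2 u2 w2"
    and init: "u1 0 = 0" "u2 0 = 0" "w1 0 = 1" "w2 0 = 1" and x: "x \<in> {0..1}"
  shows "(u1 x - u2 x)\<^sup>2 \<le> source_const * exp difference_rate / p0 * (\<omega>1 - \<omega>2)\<^sup>2"
proof -
  define s where "s = \<omega>1 - \<omega>2"
  define d where "d x = u1 x - u2 x" for x
  define g where "g x = w1 x - w2 x" for x
  \<comment> \<open>The first bracket is the homogeneous part; the other two terms come from the source.\<close>
  define F' where "F' x = (p' x * (d x)\<^sup>2 - 2 * (q x / \<omega>1) * (d x * g x))
     + 2 * ((s * w2 x) * d x) - 2 * ((s * (1 - q x / (\<omega>1 * \<omega>2)) * u2 x) * g x)" for x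
  have der: "(energy d g has_real_derivative F' x) (at x within {0..1})" if "x \<in> {0..1}" for x
  proof -
    note f = f1[unfolded flow_def, rule_format, OF that] f2[unfolded flow_def, rule_format, OF that]
    have nz: "p x \<noteq> 0" "\<omega>1 \<noteq> 0" "\<omega>2 \<noteq> 0" using p_pos[OF that] assms by auto
    have dd: "(d has_real_derivative (\<omega>1 * g x + s * w2 x) / p x) (at x within {0..1})"
      unfolding d_def[abs_def]
      by (rule derivative_eq_intros f[THEN conjunct1] refl)+
         (use nz in \<open>simp add: g_def s_def field_simps\<close>)
    have dg: "(g has_real_derivative - (\<omega>1 + q x / \<omega>1) * d x - s * (1 - q x / (\<omega>1 * \<omega>2)) * u2 x) (at x within {0..1})"
      unfolding g_def[abs_def]
      by (rule derivative_eq_intros f[THEN conjunct2] refl)+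
         (use nz in \<open>simp add: d_def s_def field_simps\<close>)
    show ?thesis
      unfolding energy_def[abs_def] F'_def
      by (rule derivative_eq_intros p_deriv[OF that] dd dg refl)+
         (use nz in \<open>simp add: field_simps power2_eq_square\<close>)
  qed
  have E2: "energy u2 w2 x \<le> exp energy_rate" if "x \<in> {0..1}" for x
    using energy_bounds(1)[OF assms(2) f2 that] init by (simp add: energy_def)
  have "energy d g x \<le> (energy d g 0 + source_const * s\<^sup>2 * x) * exp (difference_rate * x)"
  proof (rule gronwall_unit[OF der _ x])
    fix x :: real assume x: "x \<in> {0..1}"
    note e = energy_parts[OF x, where u = d and w = g] and e2 = energy_parts[OF x, where u = u2 and w = w2]
    have u2: "(u2 x)\<^sup>2 \<le> exp energy_rate / p0"
      using e2(1) E2[OF x] p0 by (meson divide_right_mono less_imp_le order.trans)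
    have w2: "(w2 x)\<^sup>2 \<le> exp energy_rate" using e2(2) E2[OF x] by linarith
    have "\<bar>q x / (\<omega>1 * \<omega>2)\<bar> \<le> Q / 1"
      unfolding abs_divide using q_bound[OF x] assms(1,2) mult_mono[of 1 \<omega>1 1 \<omega>2]
      by (intro frac_le) auto
    then have "\<bar>1 - q x / (\<omega>1 * \<omega>2)\<bar> \<le> \<bar>1 + Q\<bar>" by linarith
    then have q2: "(1 - q x / (\<omega>1 * \<omega>2))\<^sup>2 \<le> (1 + Q)\<^sup>2" by (simp only: abs_le_square_iff)
    have a: "2 * ((s * w2 x) * d x) \<le> s\<^sup>2 * exp energy_rate + energy d g x / p0"
    proof -
      have "2 * ((s * w2 x) * d x) \<le> (s * w2 x)\<^sup>2 + (d x)\<^sup>2"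
        using two_mult_le_squares[of "s * w2 x" "d x"] by linarith
      also have "\<dots> \<le> s\<^sup>2 * exp energy_rate + energy d g x / p0"
        unfolding power_mult_distrib using w2 e(1) by (intro add_mono mult_left_mono) auto
      finally show ?thesis .
    qed
    have b: "- 2 * ((s * (1 - q x / (\<omega>1 * \<omega>2)) * u2 x) * g x)
        \<le> s\<^sup>2 * ((1 + Q)\<^sup>2 * (exp energy_rate / p0)) + energy d g x"
    proof -
      have "- 2 * ((s * (1 - q x / (\<omega>1 * \<omega>2)) * u2 x) * g x)
          \<le> (s * (1 - q x / (\<omega>1 * \<omega>2)) * u2 x)\<^sup>2 + (g x)\<^sup>2"
        using two_mult_le_squares[of "s * (1 - q x / (\<omega>1 * \<omega>2)) * u2 x" "g x"] by linarith
      also have "\<dots> \<le> s\<^sup>2 * ((1 + Q)\<^sup>2 * (exp energy_rate / p0)) + energy d g x"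
        unfolding power_mult_distrib mult.assoc using q2 u2 e(2)
        by (intro add_mono mult_left_mono mult_mono) auto
      finally show ?thesis .
    qed
    have "F' x \<le> energy_rate * energy d g x + (s\<^sup>2 * exp energy_rate + energy d g x / p0)
        + (s\<^sup>2 * ((1 + Q)\<^sup>2 * (exp energy_rate / p0)) + energy d g x)"
      unfolding F'_def using a b damping_bound[OF x assms(1), of d g] by linarith
    also have "\<dots> = difference_rate * energy d g x + source_const * s\<^sup>2 * 1"
      unfolding difference_rate_def source_const_def by (simp add: algebra_simps)
    also have "\<dots> \<le> difference_rate * energy d g x + source_const * s\<^sup>2 * exp (difference_rate * x)"
      using source_const_pos energy_rate_nonneg p0 x unfolding difference_rate_def by (intro add_left_mono mult_left_mono) auto
    finally show "F' x \<le> difference_rate * energy d g x + source_const * s\<^sup>2 * exp (difference_rate * x)" .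
  qed
  also have "\<dots> \<le> (source_const * s\<^sup>2) * exp difference_rate"
  proof (rule mult_mono)
    show "energy d g 0 + source_const * s\<^sup>2 * x \<le> source_const * s\<^sup>2"
      using init x source_const_pos by (simp add: energy_def d_def g_def mult_left_le)
    show "exp (difference_rate * x) \<le> exp difference_rate"
      using x energy_rate_nonneg p0 unfolding difference_rate_def by (auto simp: mult_left_le)
  qed (use source_const_pos in auto)
  finally have "energy d g x / p0 \<le> (source_const * s\<^sup>2) * exp difference_rate / p0"
    using p0 by (intro divide_right_mono) auto
  then show ?thesis using energy_parts(1)[OF x, where u = d and w = g] unfolding d_def s_def by (simp add: mult_ac)
qed

definition frequency_gap where
  "frequency_gap = exp (- energy_rate) / p1 / ((2 + Q) * (sqrt (exp energy_rate / p0) * sqrt (source_const * exp difference_rate / p0)))"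

lemma frequency_gap_pos: "frequency_gap > 0"
  unfolding frequency_gap_def using consts_nonneg p0 source_const_pos by (intro divide_pos_pos mult_pos_pos) auto

text \<open>Let \<open>s = \<bar>\<omega>1 - \<omega>2\<bar>\<close>.  By Lagrange's identity the eigenfunctions are orthogonal, so the mean of
\<open>u1\<^sup>2\<close> equals that of \<open>u1 (u1 - u2)\<close>, which is at most a constant times \<open>s\<close>.  It is bounded below, since
multiplying the equation by \<open>u1\<close> shows that the two parts of the energy are comparable in the mean
and the energy never becomes small.\<close>

lemma dirichlet_frequency_gap:
  assumes \<omega>: "\<omega>1 \<ge> 1" "\<omega>2 \<ge> 1" "\<omega>1 \<noteq> \<omega>2" and f1: "flow \<omega>1 u1 w1" and f2: "flow \<omega>2 u2 w2"
    and init: "u1 0 = 0" "u2 0 = 0" "w1 0 = 1" "w2 0 = 1" and bdry: "u1 1 = 0" "u2 1 = 0"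
  shows "frequency_gap \<le> \<bar>\<omega>1 - \<omega>2\<bar>"
proof -
  define B where "B = sqrt (exp energy_rate / p0) * sqrt (source_const * exp difference_rate / p0)"
  define s where "s = \<bar>\<omega>1 - \<omega>2\<bar>"
  define D where "D = \<omega>1\<^sup>2 - \<omega>2\<^sup>2"
  have D: "D \<noteq> 0" unfolding D_def using \<omega> by (auto simp: power2_eq_iff)
  \<comment> \<open>The integrals of the sketch above, written as boundary terms: the second summand has derivative
    a multiple of \<open>u1 u2\<close>, the third one measures the imbalance between the two parts of the energy. Both
    vanish at 0 and 1.  Monotonicity of \<open>\<Phi>\<close> then is the desired inequality.\<close>
  define \<Phi> where "\<Phi> x = (2 + Q) * (B * s) * x + (2 + Q) * ((\<omega>2 * (u1 x * w2 x) - \<omega>1 * (u2 x * w1 x)) / D)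
      + u1 x * w1 x / \<omega>1 - exp (- energy_rate) / p1 * x" for x
  define \<Phi>' where "\<Phi>' x = (2 + Q) * (B * s) + (2 + Q) * (u1 x * u2 x)
      + ((w1 x)\<^sup>2 / p x - (1 + q x / \<omega>1\<^sup>2) * (u1 x)\<^sup>2) - exp (- energy_rate) / p1" for x
  have der: "(\<Phi> has_real_derivative \<Phi>' x) (at x within {0..1})" if "x \<in> {0..1}" for x
  proof -
    note f = f1[unfolded flow_def, rule_format, OF that] f2[unfolded flow_def, rule_format, OF that]
    have nz: "p x \<noteq> 0" "\<omega>1 \<noteq> 0" "\<omega>2 \<noteq> 0" using p_pos[OF that] \<omega> by auto
    have a: "((\<lambda>x. u1 x * w1 x / \<omega>1) has_real_derivative (w1 x)\<^sup>2 / p x - (1 + q x / \<omega>1\<^sup>2) * (u1 x)\<^sup>2) (at x within {0..1})"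
      by (rule derivative_eq_intros f[THEN conjunct1] f[THEN conjunct2] refl)+
         (use nz in \<open>auto simp: field_simps power2_eq_square\<close>)
    have "((\<lambda>x. \<omega>2 * (u1 x * w2 x) - \<omega>1 * (u2 x * w1 x)) has_real_derivative D * (u1 x * u2 x)) (at x within {0..1})"
      by (rule derivative_eq_intros f[THEN conjunct1] f[THEN conjunct2] refl)+
         (use nz in \<open>simp add: D_def field_simps power2_eq_square\<close>)
    from DERIV_cdivide[OF this, of D] have b: "((\<lambda>x. (\<omega>2 * (u1 x * w2 x) - \<omega>1 * (u2 x * w1 x)) / D) has_real_derivative u1 x * u2 x) (at x within {0..1})"
      using D by simp
    show ?thesis unfolding \<Phi>_def[abs_def] \<Phi>'_def
      by (rule derivative_eq_intros a b refl)+ simp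
  qed
  have pos: "\<Phi>' x \<ge> 0" if x: "x \<in> {0..1}" for x
  proof -
    have E: "energy u1 w1 x \<le> exp energy_rate" "exp (- energy_rate) \<le> energy u1 w1 x"
      using energy_bounds[OF \<omega>(1) f1 x] init by (auto simp: energy_def)
    have "(u1 x)\<^sup>2 \<le> exp energy_rate / p0"
      using energy_parts(1)[OF x, where u = u1 and w = w1] E(1) p0 by (meson divide_right_mono less_imp_le order.trans)
    then have "\<bar>u1 x\<bar> \<le> sqrt (exp energy_rate / p0)" by (simp add: real_le_rsqrt)
    moreover have "\<bar>u1 x - u2 x\<bar> \<le> sqrt (source_const * exp difference_rate / p0) * s"
    proof -
      have "\<bar>u1 x - u2 x\<bar> \<le> sqrt (source_const * exp difference_rate / p0 * s\<^sup>2)"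
        using flow_difference[OF \<omega>(1,2) f1 f2 init x] unfolding s_def by (intro real_le_rsqrt) simp
      also have "\<dots> = sqrt (source_const * exp difference_rate / p0) * s"
        unfolding real_sqrt_mult[of _ "s\<^sup>2"] by (simp only: real_sqrt_abs) (simp add: s_def)
      finally show ?thesis .
    qed
    ultimately have "\<bar>u1 x\<bar> * \<bar>u1 x - u2 x\<bar> \<le> sqrt (exp energy_rate / p0) * (sqrt (source_const * exp difference_rate / p0) * s)"
      by (intro mult_mono) (use p0 in auto)
    then have "\<bar>u1 x * (u1 x - u2 x)\<bar> \<le> B * s" unfolding B_def abs_mult by simp
    then have "(u1 x)\<^sup>2 \<le> B * s + u1 x * u2 x" by (simp add: power2_eq_square algebra_simps)
    then have 1: "(2 + Q) * (u1 x)\<^sup>2 \<le> (2 + Q) * (B * s + u1 x * u2 x)"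
      using consts_nonneg by (intro mult_left_mono) auto
    have "\<bar>q x / \<omega>1\<^sup>2\<bar> \<le> Q / 1"
      unfolding abs_divide using q_bound[OF x] \<omega>(1) by (intro frac_le) auto
    then have "1 + q x / \<omega>1\<^sup>2 \<le> 1 + Q" by linarith
    then have 2: "(1 + q x / \<omega>1\<^sup>2) * (u1 x)\<^sup>2 \<le> (1 + Q) * (u1 x)\<^sup>2"
      by (rule mult_right_mono) simp
    have "exp (- energy_rate) / p1 \<le> energy u1 w1 x / p x"
      using E(2) p_bounds[OF x] p_pos[OF x] order.trans[OF exp_ge_zero E(2)] by (intro frac_le) auto
    also have "\<dots> = (u1 x)\<^sup>2 + (w1 x)\<^sup>2 / p x"
      unfolding energy_def using p_pos[OF x] by (simp add: add_divide_distrib)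
    finally show ?thesis unfolding \<Phi>'_def using 1 2 by (simp add: algebra_simps)
  qed
  have "\<Phi> 0 \<le> \<Phi> 1"
  proof (rule DERIV_nonneg_imp_increasing_open[of 0 1 \<Phi>])
    fix t :: real assume t: "0 < t" "t < 1"
    then have "at t within {0..1} = at t" by (intro at_within_interior) auto
    then show "\<exists>y. DERIV \<Phi> t :> y \<and> y \<ge> 0" using der[of t] pos[of t] t by auto
  next
    show "continuous_on {0..1} \<Phi>" using der by (intro DERIV_continuous_on) auto
  qed simp
  then have "exp (- energy_rate) / p1 \<le> (2 + Q) * B * s"
    unfolding \<Phi>_def using init bdry by simp
  moreover have "(2 + Q) * B > 0"
    unfolding B_def using consts_nonneg p0 source_const_pos by (intro mult_pos_pos) auto
  ultimately have "exp (- energy_rate) / p1 / ((2 + Q) * B) \<le> s"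
    by (simp only: pos_divide_le_eq mult.commute[of s])
  then show ?thesis unfolding frequency_gap_def B_def s_def .
qed

lemma classical_eigenvalue_flow:
  assumes "classical_eigenvalue p q (\<omega>\<^sup>2)" "\<omega> \<ge> 1"
  shows "\<exists>u w. flow \<omega> u w \<and> u 0 = 0 \<and> w 0 = 1 \<and> u 1 = 0"
proof -
  obtain h v x0 where hd: "\<And>x. x \<in> {0..1} \<Longrightarrow> (h has_real_derivative v x / p x) (at x within {0..1})"
    and vd: "\<And>x. x \<in> {0..1} \<Longrightarrow> (v has_real_derivative - (q x + \<omega>\<^sup>2) * h x) (at x within {0..1})"
    and h: "h 0 = 0" "h 1 = 0" and x0: "x0 \<in> {0..1}" "h x0 \<noteq> 0"
    using assms(1) unfolding classical_eigenvalue_def by blast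
  have scaled: "flow \<omega> (\<lambda>x. a * (\<omega> * h x)) (\<lambda>x. a * v x)" for a
    unfolding flow_def
  proof (intro ballI conjI)
    fix x :: real assume x: "x \<in> {0..1}"
    show "((\<lambda>x. a * (\<omega> * h x)) has_real_derivative \<omega> * (a * v x) / p x) (at x within {0..1})"
      by (rule derivative_eq_intros hd[OF x] refl)+ simp
    show "((\<lambda>x. a * v x) has_real_derivative - (\<omega> + q x / \<omega>) * (a * (\<omega> * h x))) (at x within {0..1})"
      by (rule derivative_eq_intros vd[OF x] refl)+
         (use assms(2) in \<open>simp add: field_simps power2_eq_square\<close>)
  qed
  have "v 0 \<noteq> 0"
  proof
    assume "v 0 = 0"
    then have "energy (\<lambda>x. 1 * (\<omega> * h x)) (\<lambda>x. 1 * v x) x0 \<le> 0"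
      using energy_bounds(1)[OF assms(2) scaled x0(1), of 1] h by (simp add: energy_def)
    then have "energy (\<lambda>x. 1 * (\<omega> * h x)) (\<lambda>x. 1 * v x) x0 / p0 \<le> 0"
      using p0 by (rule divide_nonpos_pos)
    then have "(1 * (\<omega> * h x0))\<^sup>2 \<le> 0"
      using energy_parts(1)[OF x0(1), where u = "\<lambda>x. 1 * (\<omega> * h x)" and w = "\<lambda>x. 1 * v x"]
      by (rule order.trans[rotated])
    then show False using x0(2) assms(2) by simp
  qed
  then have "flow \<omega> (\<lambda>x. inverse (v 0) * (\<omega> * h x)) (\<lambda>x. inverse (v 0) * v x) \<and>
      inverse (v 0) * (\<omega> * h 0) = 0 \<and> inverse (v 0) * v 0 = 1 \<and> inverse (v 0) * (\<omega> * h 1) = 0"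
    using scaled[of "inverse (v 0)"] h by simp
  then show ?thesis by (intro exI)
qed

lemma classical_eigenvalue_gap:
  assumes "classical_eigenvalue p q \<mu>1" "classical_eigenvalue p q \<mu>2" "\<mu>1 \<ge> 1" "\<mu>2 \<ge> 1" "\<mu>1 \<noteq> \<mu>2"
  shows "frequency_gap \<le> \<bar>sqrt \<mu>1 - sqrt \<mu>2\<bar>"
proof -
  have \<omega>: "sqrt \<mu>1 \<ge> 1" "sqrt \<mu>2 \<ge> 1" "sqrt \<mu>1 \<noteq> sqrt \<mu>2" using assms by auto
  obtain u1 w1 u2 w2 where "flow (sqrt \<mu>1) u1 w1" "u1 0 = 0" "w1 0 = 1" "u1 1 = 0"
    "flow (sqrt \<mu>2) u2 w2" "u2 0 = 0" "w2 0 = 1" "u2 1 = 0"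
    using classical_eigenvalue_flow[of "sqrt \<mu>1"] classical_eigenvalue_flow[of "sqrt \<mu>2"] assms \<omega> by auto
  then show ?thesis using dirichlet_frequency_gap[OF \<omega>] by blast
qed

end

text \<open>The square roots grow at least linearly, and \<open>\<lambda>\<^sub>n\<^sub>+\<^sub>1 - \<lambda>\<^sub>n\<close> is the product of the difference and the sum
of the square roots.  The finitely many small indices only affect the constant.\<close>

lemma quadratic_gap_of_sqrt_gap:
  fixes lam :: "nat \<Rightarrow> real"
  assumes mono: "\<And>i j. 1 \<le> i \<Longrightarrow> i < j \<Longrightarrow> lam i < lam j" and "filterlim lam at_top sequentially"
    and "\<delta> > 0" and gap: "\<And>i j. 1 \<le> i \<Longrightarrow> i < j \<Longrightarrow> 1 \<le> lam i \<Longrightarrow> \<delta> \<le> sqrt (lam j) - sqrt (lam i)"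
  shows "\<exists>c>0. \<forall>i j. 1 \<le> i \<longrightarrow> i < j \<longrightarrow> c * ((real j)\<^sup>2 - (real i)\<^sup>2) \<le> lam j - lam i"
proof -
  obtain n1 where n1: "\<And>n. n \<ge> n1 \<Longrightarrow> lam n \<ge> 1"
    using assms(2) unfolding filterlim_at_top eventually_sequentially by metis
  define n0 where "n0 = max 1 n1"
  have n0: "n0 \<ge> 1" "\<And>n. n \<ge> n0 \<Longrightarrow> lam n \<ge> 1" unfolding n0_def using n1 by auto
  have root: "sqrt (lam (n0 + k)) \<ge> \<delta> * real k" for k
  proof (cases "k = 0")
    case True
    then show ?thesis using n0(2)[of n0] by simp
  next
    case False
    have "\<delta> * real k \<le> sqrt (lam (n0 + k)) - sqrt (lam n0)"
    proof (induction k)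
      case (Suc k)
      have "\<delta> \<le> sqrt (lam (n0 + Suc k)) - sqrt (lam (n0 + k))"
        using n0 by (intro gap) auto
      then show ?case using Suc by (simp add: algebra_simps)
    qed simp
    moreover have "sqrt (lam n0) \<ge> 0" using n0(2)[of n0] by simp
    ultimately show ?thesis by linarith
  qed
  define G where "G = Min ((\<lambda>n. lam (Suc n) - lam n) ` {1..2 * n0})"
  have G: "G > 0" unfolding G_def using n0(1) mono by (subst Min_gr_iff) auto
  define c where "c = min (\<delta>\<^sup>2 / 2) (G / (4 * real n0 + 1))"
  have c: "c > 0" unfolding c_def using \<open>\<delta> > 0\<close> G by simp
  have step: "c * (2 * real n + 1) \<le> lam (Suc n) - lam n" if "n \<ge> 1" for n
  proof (cases "n \<le> 2 * n0")
    case True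
    have "c * (2 * real n + 1) \<le> (G / (4 * real n0 + 1)) * (4 * real n0 + 1)"
      using True c G unfolding c_def by (intro mult_mono) auto
    also have "\<dots> = G" by (simp add: add_nonneg_eq_0_iff)
    also have "\<dots> \<le> lam (Suc n) - lam n" unfolding G_def using True that by (intro Min_le) auto
    finally show ?thesis .
  next
    case False
    define k where "k = n - n0"
    have n: "n = n0 + k" "2 * real n0 \<le> real n" using False unfolding k_def by auto
    have k: "real k = real n - real n0" using n by simp
    have "\<delta>\<^sup>2 / 2 * (2 * real n + 1) \<le> \<delta>\<^sup>2 * (2 * real k + 1)"
    proof -
      have "(2 * real n + 1) / 2 \<le> 2 * real k + 1" using n k by simp
      from mult_left_mono[OF this, of "\<delta>\<^sup>2"] show ?thesis by simp
    qed
    also have "\<dots> = \<delta> * (\<delta> * real (Suc k) + \<delta> * real k)" by (simp add: power2_eq_square algebra_simps)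
    also have "\<dots> \<le> (sqrt (lam (Suc n)) - sqrt (lam n)) * (sqrt (lam (Suc n)) + sqrt (lam n))"
      using root[of k] root[of "Suc k"] gap[of n "Suc n"] mono[of n "Suc n"] n0 n that \<open>\<delta> > 0\<close>
      by (intro mult_mono add_mono) auto
    also have "\<dots> = lam (Suc n) - lam n"
      using n0(2)[of n] n0(2)[of "Suc n"] n by (simp add: algebra_simps)
    finally have "\<delta>\<^sup>2 / 2 * (2 * real n + 1) \<le> lam (Suc n) - lam n" .
    moreover have "c * (2 * real n + 1) \<le> \<delta>\<^sup>2 / 2 * (2 * real n + 1)"
      unfolding c_def by (intro mult_right_mono min.cobounded1) auto
    ultimately show ?thesis by linarith
  qed
  have "c * ((real j)\<^sup>2 - (real i)\<^sup>2) \<le> lam j - lam i" if "1 \<le> i" "i < j" for i j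
  proof -
    have "c * ((real (i + k))\<^sup>2 - (real i)\<^sup>2) \<le> lam (i + k) - lam i" for k
    proof (induction k)
      case (Suc k)
      have "c * ((real (i + Suc k))\<^sup>2 - (real i)\<^sup>2) = c * ((real (i + k))\<^sup>2 - (real i)\<^sup>2) + c * (2 * real (i + k) + 1)"
        by (simp add: power2_eq_square algebra_simps)
      then show ?case using Suc step[of "i + k"] \<open>1 \<le> i\<close> by simp
    qed simp
    from this[of "j - i"] show ?thesis using that by simp
  qed
  then show ?thesis using c by blast
qed

lemma SL_eigenvalue_quadratic_gap:
  assumes smooth: "smooth_near_unit p" "smooth_near_unit q" and pos: "\<forall>x\<in>{0..1}. p x > 0"
    and seq: "SL_eigenvalue_seq p q lam"
  shows "\<exists>c>0. \<forall>i j. 1 \<le> i \<longrightarrow> i < j \<longrightarrow> c * ((real j)\<^sup>2 - (real i)\<^sup>2) \<le> lam j - lam i"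
proof -
  obtain P U where U: "open U" "{0..1} \<subseteq> U" and P: "\<And>x. x \<in> U \<Longrightarrow> (P has_real_derivative deriv P x) (at x)"
    and P': "continuous_on U (deriv P)" and Pp: "\<And>x. x \<in> {0..1} \<Longrightarrow> P x = p x"
    using smooth_near_unit_derivative[OF smooth(1)] by metis
  have pd: "(p has_real_derivative deriv P x) (at x within {0..1})" if "x \<in> {0..1}" for x
  proof (rule has_field_derivative_transform_within[where f = P and d = 1])
    show "(P has_real_derivative deriv P x) (at x within {0..1})"
      using P U(2) that by (meson has_field_derivative_at_within subsetD)
  qed (use that Pp in auto)
  have pc: "continuous_on {0..1} p" by (rule DERIV_continuous_on[OF pd])
  have "continuous_on {0..1} (deriv P)" using P' U(2) continuous_on_subset by blast
  then obtain B1 where B1: "\<And>x. x \<in> {0..1} \<Longrightarrow> \<bar>deriv P x\<bar> \<le> B1"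
    using continuous_unit_bounded_measurable(2) by blast
  obtain Qf V where V: "{0..1} \<subseteq> V" "\<And>x. x \<in> V \<Longrightarrow> (Qf has_real_derivative deriv Qf x) (at x)"
    and Qq: "\<And>x. x \<in> {0..1} \<Longrightarrow> Qf x = q x"
    using smooth_near_unit_derivative[OF smooth(2)] by metis
  have "continuous_on {0..1} Qf" using V by (meson DERIV_isCont continuous_at_imp_continuous_on subsetD)
  then obtain B2 where "\<And>x. x \<in> {0..1} \<Longrightarrow> \<bar>Qf x\<bar> \<le> B2"
    using continuous_unit_bounded_measurable(2) by blast
  then have B2: "\<And>x. x \<in> {0..1} \<Longrightarrow> \<bar>q x\<bar> \<le> B2" using Qq by metis
  obtain x0 where x0: "x0 \<in> {0..1}" "\<And>x. x \<in> {0..1} \<Longrightarrow> p x0 \<le> p x"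
    using continuous_attains_inf[of "{0..1}" p] pc by auto
  obtain x1 where x1: "x1 \<in> {0..1}" "\<And>x. x \<in> {0..1} \<Longrightarrow> p x \<le> p x1"
    using continuous_attains_sup[of "{0..1}" p] pc by auto
  interpret SL_coefficients p "deriv P" q "p x0" "p x1" B1 B2
    by unfold_locales (use x0 x1 pos pd B1 B2 in auto)
  have lam: "strict_mono_on {1..} lam" "lam ` {1..} = {\<mu>. SL_eigenvalue p q \<mu>}" "filterlim lam at_top sequentially"
    using seq unfolding SL_eigenvalue_seq_def by auto
  have mono: "lam i < lam j" if "1 \<le> i" "i < j" for i j
    using lam(1) that by (auto simp: strict_mono_on_def)
  have cl: "classical_eigenvalue p q (lam i)" if "1 \<le> i" for i
  proof -
    have "SL_eigenvalue p q (lam i)" using lam(2) that by auto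
    then show ?thesis using SL_eigenvalue_classical smooth pos by blast
  qed
  show ?thesis
  proof (rule quadratic_gap_of_sqrt_gap[OF mono lam(3) frequency_gap_pos])
    fix i j assume ij: "1 \<le> i" "i < j" "1 \<le> lam i"
    then have "lam i < lam j" using mono by blast
    moreover have "frequency_gap \<le> \<bar>sqrt (lam i) - sqrt (lam j)\<bar>"
      using ij \<open>lam i < lam j\<close> cl by (intro classical_eigenvalue_gap) auto
    moreover have "sqrt (lam i) < sqrt (lam j)" using \<open>lam i < lam j\<close> by simp
    ultimately show "frequency_gap \<le> sqrt (lam j) - sqrt (lam i)" by linarith
  qed
qed

section \<open>Roots of the perturbed Prony polynomial of a Sturm-Liouville spectrum\<close>

theorem theorem3:
  fixes p q :: "real \<Rightarrow> real" and lam :: "nat \<Rightarrow> real" and \<Delta>0 \<tau> l M :: real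
  assumes "smooth_near_unit p" and "smooth_near_unit q"
    and "\<forall>x\<in>{0..1}. p x > 0"
    and "SL_eigenvalue_seq p q lam"
    and "l > 1" and "M > 0"
    and "\<Delta>0 > 0" and "separation_constant lam \<Delta>0 \<tau>"
  shows "(\<exists>\<epsilon>0>0. \<forall>\<Delta>\<ge>\<Delta>0. \<forall>N n. 1 \<le> n \<and> n \<le> N \<longrightarrow>
            (\<forall>y. admissible_amplitudes l M N y \<longrightarrow> (\<forall>\<epsilon>\<in>{0..\<epsilon>0}.
               \<exists>z. poly (prony_poly lam \<Delta> N y \<epsilon>) z = 0 \<and>
                   cmod (complex_of_real (node lam \<Delta> n) - z) \<le> \<tau> * node lam \<Delta> n)))
       \<and> (\<forall>T>0. \<exists>\<epsilon>T>0. \<forall>N n. 1 \<le> n \<and> n \<le> N \<longrightarrow>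
            (\<forall>y. admissible_amplitudes l M N y \<longrightarrow> (\<forall>\<epsilon>\<in>{0..\<epsilon>T}.
               \<exists>z. poly (prony_poly lam (T / real N) N y \<epsilon>) z = 0 \<and>
                   cmod (complex_of_real (node lam (T / real N) n) - z)
                     \<le> \<tau> * node lam (T / real N) n)))"
proof -
  obtain c where c: "c > 0" "\<And>i j. 1 \<le> i \<Longrightarrow> i < j \<Longrightarrow> c * ((real j)\<^sup>2 - (real i)\<^sup>2) \<le> lam j - lam i"
    using SL_eigenvalue_quadratic_gap[OF assms(1-4)] by blast
  have \<tau>: "0 < \<tau>" "\<tau> < 1/2" using assms(8) unfolding separation_constant_def by auto
  show ?thesis
    using prony_root_separated_nodes[OF c(2) c(1) assms(7,5,6,8)]
      prony_root_fixed_horizon[OF c(2) c(1) _ assms(5,6) \<tau>] by blast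
qed

end
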